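(* Let $1<p<p_*$, $T>0$, $\delta\in(0,1)$ and $\lambda:=(1-\delta)/(4T)$. There exists $\gamma_2=\gamma_2(N,p,\delta)>0$ such that: if $\mu$ is a Radon measure on $\mathbf{R}^N$ with $\operatorname{supp}\mu\subset D$ satisfying $$\sup_{x\in D}\frac{1}{|B(x,T^{1/2})|}\int_{B(x,T^{1/2})}e^{-\lambda y_N^2}\,d\mu(y)\le\gamma_2T^{-\frac{1}{2(p-1)}},$$ then there exists a solution $u$ of the initial-boundary problem with initial data $\mu$ in $[0,T)$ such that $0\le u(x,t)\le2[S(t)\mu](x)$ for $(x,t)\in D\times(0,T)$.
   Context: Let $N\ge1$, $p>1$, $p_*:=1+\frac1N$. Write $x=(x',x_N)$, $\mathbf{R}^N_+=\{x_N>0\}$, $D:=\overline{\mathbf{R}^N_+}$, identifying $\partial\mathbf{R}^N_+$ with $\mathbf{R}^{N-1}$; $B(x,r)$ is the open ball, $|E|$ Lebesgue measure. Let $\Gamma_N(x,t)=(4\pi t)^{-N/2}e^{-|x|^2/(4t)}$, $G(x,y,t):=\Gamma_N(x-y,t)+\Gamma_N(x-y_*,t)$, $y_*=(y',-y_N)$, and $[S(t)\mu](x):=\int_DG(x,y,t)\,d\mu(y)$ (a nonnegative locally integrable function $\phi$ is identified with the measure $\phi\,dx$). A nonnegative continuous $u$ on $D\times(0,T)$ is a solution of the initial-boundary problem ($\partial_tu=\Delta u$ in $\mathbf{R}^N_+$, $\partial_\nu u=u^p$ on $\partial\mathbf{R}^N_+$, $u(\cdot,0)=\mu$) in $[0,T)$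 if for all $(x,t)\in D\times(0,T)$, $u(x,t)=[S(t)\mu](x)+\int_0^t\int_{\mathbf{R}^{N-1}}G(x,(y',0),t-s)u(y',0,s)^p\,dy'\,ds.$ *)

theory Defs
  imports "HOL-Analysis.Analysis"
begin

text \<open>Points of R^N are represented as pairs (x', x_N), where x' :: nat => real is an
 extensional function on the index set {..<N-1} (this covers N = 1, where x' ranges over R^0).\<close>

type_synonym pt = "(nat \<Rightarrow> real) \<times> real"

definition bdry :: "nat \<Rightarrow> (nat \<Rightarrow> real) measure" where
  "bdry N = PiM {..<N-1} (\<lambda>_. lborel)"

definition RN :: "nat \<Rightarrow> pt measure" where
  "RN N = bdry N \<Otimes>\<^sub>M lborel"

definition Dset :: "nat \<Rightarrow> pt set" where
  "Dset N = (PiE {..<N-1} (\<lambda>_. UNIV)) \<times> {0..}"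

definition sqdist :: "nat \<Rightarrow> pt \<Rightarrow> pt \<Rightarrow> real" where
  "sqdist N x y = (\<Sum>i<N-1. (fst x i - fst y i)^2) + (snd x - snd y)^2"

definition Ball :: "nat \<Rightarrow> pt \<Rightarrow> real \<Rightarrow> pt set" where
  "Ball N x r = {y \<in> space (RN N). sqrt (sqdist N x y) < r}"

definition Gam :: "nat \<Rightarrow> pt \<Rightarrow> pt \<Rightarrow> real \<Rightarrow> real" where
  "Gam N x y t = (4 * pi * t) powr (- real N / 2) * exp (- sqdist N x y / (4 * t))"

definition Gk :: "nat \<Rightarrow> pt \<Rightarrow> pt \<Rightarrow> real \<Rightarrow> real" where
  "Gk N x y t = Gam N x y t + Gam N x (fst y, - snd y) t"

definition Sop :: "nat \<Rightarrow> pt measure \<Rightarrow> real \<Rightarrow> pt \<Rightarrow> ennreal" where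
  "Sop N \<mu> t x = (\<integral>\<^sup>+ y. ennreal (Gk N x y t) \<partial>\<mu>)"

definition radon_on_D :: "nat \<Rightarrow> pt measure \<Rightarrow> bool" where
  "radon_on_D N \<mu> \<longleftrightarrow> sets \<mu> = sets (RN N)
     \<and> (\<forall>x r. emeasure \<mu> (Ball N x r) < \<infinity>)
     \<and> emeasure \<mu> (space (RN N) - Dset N) = 0"

definition is_solution :: "nat \<Rightarrow> real \<Rightarrow> pt measure \<Rightarrow> real \<Rightarrow> (pt \<Rightarrow> real \<Rightarrow> real) \<Rightarrow> bool" where
  "is_solution N p \<mu> T u \<longleftrightarrow>
     (\<forall>x\<in>Dset N. \<forall>t\<in>{0<..<T}. 0 \<le> u x t)
   \<and> continuous_on (Dset N \<times> {0<..<T}) (\<lambda>(x, t). u x t)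
   \<and> (\<forall>x\<in>Dset N. \<forall>t\<in>{0<..<T}.
        ennreal (u x t) = Sop N \<mu> t x +
          (\<integral>\<^sup>+ s. indicator {0<..<t} s *
             (\<integral>\<^sup>+ y'. ennreal (Gk N x (y', 0) (t - s) * u (y', 0) s powr p) \<partial>bdry N) \<partial>lborel))"

end

theory Submission
  imports Defs "HOL-Probability.Probability"
begin

text \<open>The Gaussian factor in \<open>z\<^sub>N\<close> with \<open>t < T\<close> absorbs the weight, so the ball condition bounds
  \<open>S(s)\<mu>\<close> on the boundary by \<open>A s\<^bsup>-N/2\<^esup>\<close>, with \<open>A\<close> proportional to \<open>\<gamma>\<close>. Hence a function \<open>u \<le> 2 S\<mu>\<close> satisfies
  \<open>u\<^sup>p \<le> B s\<^bsup>-a\<^esup> S(s)\<mu>\<close> on the boundary, where \<open>a = N(p - 1)/2 < 1/2\<close>. By the semigroup property in the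
  tangential variables, the boundary integral of \<open>G(x,y,t - s) G(y,z,s)\<close> is at most
  \<open>C (t/(s(t - s)))\<^bsup>1/2\<^esup> G(x,z,t)\<close>, so after a convergent beta integral in \<open>s\<close> the Duhamel term is at most
  \<open>S(t)\<mu>\<close> when \<open>\<gamma>\<close> is small. The Picard iterates therefore increase to a solution below \<open>2 S\<mu>\<close>. It is
  continuous by Pratt's lemma, since the Duhamel term of \<open>B s\<^bsup>-a\<^esup> S(s)\<mu>\<close> is explicit and continuous.\<close>

section \<open>Heat kernels on the half space\<close>

declare One_nat_def [simp del] \<comment> \<open>keeps \<open>N - 1\<close> from being rewritten to \<open>N - Suc 0\<close>\<close>

text \<open>The boundary integral runs over the tangential variables only. Tangential kernels
  therefore compose exactly, while the two normal Gaussians are merely multiplied. Their product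
  lacks one integration, which is the origin of the singular factor in s and t - s; together with
  s^(-a) it is integrable exactly when a < 1/2, that is, p < 1 + 1/N. The measure may grow like
  exp(\<lambda> y_N^2), so no bound on S(t)\<mu> uniform in x_N is at hand. None is asked for: only
  p - 1 of the p powers of u are estimated, and only on the boundary, while one factor S(s)\<mu> is
  kept. The majorant of u^p is then linear in \<mu> up to its coefficient, so its potential can be
  computed, and the Duhamel term is compared pointwise with S(t)\<mu> itself instead of in a norm.
  The power of T in the hypothesis is the scale invariant one, so T drops out of the smallness
  condition. The iteration takes place in \<open>ennreal\<close>, where its limit exists before
  finiteness is known.\<close>

definition heat1 :: "real \<Rightarrow> real \<Rightarrow> real" where
  "heat1 t a = normal_density 0 (sqrt (2 * t)) a"

text \<open>The tangential heat kernel. For \<open>n = 0\<close> it is the empty product 1, so N = 1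
  needs no case of its own.\<close>

definition heat_prod :: "nat \<Rightarrow> (nat \<Rightarrow> real) \<Rightarrow> (nat \<Rightarrow> real) \<Rightarrow> real \<Rightarrow> real" where
  "heat_prod n x z t = (\<Prod>i<n. heat1 t (x i - z i))"

lemma heat1_nonneg [simp]: "0 \<le> heat1 t a"
  by (simp add: heat1_def)

lemma heat_prod_nonneg [simp]: "0 \<le> heat_prod n x z t"
  by (simp add: heat_prod_def prod_nonneg)

lemma heat1_eq: "0 < t \<Longrightarrow> heat1 t a = (4 * pi * t) powr (- 1 / 2) * exp (- a\<^sup>2 / (4 * t))"
  by (simp add: heat1_def normal_density_def powr_minus powr_half_sqrt field_simps)

lemma heat1_minus [simp]: "heat1 t (- a) = heat1 t a"
  by (simp add: heat1_def normal_density_def)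

lemma heat1_measurable [measurable]:
  assumes [measurable]: "f \<in> borel_measurable M" "g \<in> borel_measurable M"
  shows "(\<lambda>x. heat1 (f x) (g x)) \<in> borel_measurable M"
  unfolding heat1_def normal_density_def by measurable

text \<open>The exponent N/2 splits as (N - 1)/2 + 1/2. With the normal variable separated, its
  factors are constants in every integral over the boundary.\<close>

lemma Gam_eq_heat_prod:
  assumes "N \<ge> 1" "0 < t"
  shows "Gam N x y t = heat_prod (N - 1) (fst x) (fst y) t * heat1 t (snd x - snd y)"
proof -
  have N: "real N = real (N - 1) + 1" using assms by simp
  have "heat_prod (N - 1) (fst x) (fst y) t
      = ((4 * pi * t) powr (- 1 / 2)) ^ (N - 1) * exp (- (\<Sum>i<N-1. (fst x i - fst y i)^2) / (4 * t))"
    using assms by (simp add: heat_prod_def heat1_eq prod.distrib sum_negf sum_divide_distrib flip: exp_sum)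
  moreover have "((4 * pi * t) powr (- 1 / 2)) ^ (N - 1) * (4 * pi * t) powr (- 1 / 2)
      = (4 * pi * t) powr (- real N / 2)"
    using assms by (subst N, simp add: powr_add [symmetric] powr_realpow [symmetric] powr_powr field_simps)
  ultimately show ?thesis
    using assms by (simp add: Gam_def sqdist_def heat1_eq exp_add [symmetric] add_divide_distrib diff_divide_distrib mult_ac)
       (simp flip: exp_add mult.assoc)
qed

lemma nn_integral_heat1_translate:
  assumes "0 < t" shows "(\<integral>\<^sup>+ y. ennreal (heat1 t (a - y)) \<partial>lborel) = 1"
proof -
  have "(\<integral>\<^sup>+ y. ennreal (heat1 t (a - y)) \<partial>lborel) = (\<integral>\<^sup>+ y. ennreal (heat1 t y) \<partial>lborel)"
    by (subst nn_integral_real_affine [where c = "-1" and t = a]) auto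
  also have "\<dots> = 1"
    unfolding heat1_def using assms
    by (subst nn_integral_eq_integral) (auto intro: integrable_normal_density)
  finally show ?thesis .
qed

text \<open>Translating y by b leaves a convolution of two centred normal densities, whose variances
  2t and 2s add. This is why \<open>heat1\<close> is defined through
  \<open>normal_density\<close>.\<close>

lemma nn_integral_heat1_semigroup:
  assumes "0 < s" "0 < t"
  shows "(\<integral>\<^sup>+ y. ennreal (heat1 t (a - y)) * ennreal (heat1 s (y - b)) \<partial>lborel) = ennreal (heat1 (t + s) (a - b))"
proof -
  have "(\<integral>\<^sup>+ y. ennreal (heat1 t (a - y)) * ennreal (heat1 s (y - b)) \<partial>lborel)
      = (\<integral>\<^sup>+ y. ennreal (heat1 t ((a - b) - y) * heat1 s y) \<partial>lborel)"
    by (subst nn_integral_real_affine [where c = 1 and t = b]) (auto simp: ennreal_mult algebra_simps)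
  also have "\<dots> = ennreal (heat1 (t + s) (a - b))"
    unfolding heat1_def using assms
      fun_cong [OF conv_normal_density_zero_mean [of "sqrt (2 * t)" "sqrt (2 * s)"], of "a - b"]
    by (simp add: distrib_left)
  finally show ?thesis .
qed

section \<open>Measure structure of the boundary and of R^N\<close>

lemma product_sigma_finite_lborel: "product_sigma_finite (\<lambda>_::nat. lborel :: real measure)"
  by (simp add: product_sigma_finite_def lborel.sigma_finite_measure_axioms)

lemma sigma_finite_bdry: "sigma_finite_measure (bdry N)"
  unfolding bdry_def using product_sigma_finite.sigma_finite [OF product_sigma_finite_lborel] by simp

lemma sigma_finite_RN: "sigma_finite_measure (RN N)"
proof -
  interpret pair_sigma_finite "bdry N" "lborel :: real measure"
    by (simp add: pair_sigma_finite_def sigma_finite_bdry lborel.sigma_finite_measure_axioms)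
  show ?thesis unfolding RN_def by (rule sigma_finite_measure_axioms)
qed

lemma space_bdry: "space (bdry N) = PiE {..<N-1} (\<lambda>_. UNIV)"
  by (simp add: bdry_def space_PiM)

lemma space_RN: "space (RN N) = PiE {..<N-1} (\<lambda>_. UNIV) \<times> UNIV"
  by (simp add: RN_def space_pair_measure space_bdry)

lemma Dset_eq: "Dset N = {x \<in> space (RN N). 0 \<le> snd x}"
  by (simp add: Dset_def space_RN set_eq_iff mem_Times_iff)

lemma measurable_bdry_component [measurable]:
  "i < N - 1 \<Longrightarrow> (\<lambda>y. y i) \<in> borel_measurable (bdry N)"
  unfolding bdry_def by (rule measurable_component_singleton [where M = "\<lambda>_. lborel", simplified]) simp

lemma measurable_bdry_comp:
  assumes "f \<in> M \<rightarrow>\<^sub>M bdry N" "i < N - 1"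
  shows "(\<lambda>w. f w i) \<in> borel_measurable M"
  using measurable_compose [OF assms(1) measurable_bdry_component [OF assms(2)]] .

lemma measurable_fst_RN [measurable]: "fst \<in> RN N \<rightarrow>\<^sub>M bdry N"
  and measurable_snd_RN [measurable]: "snd \<in> borel_measurable (RN N)"
  and measurable_Pair_RN [measurable (raw)]:
    "f \<in> M \<rightarrow>\<^sub>M bdry N \<Longrightarrow> g \<in> borel_measurable M \<Longrightarrow> (\<lambda>w. (f w, g w)) \<in> M \<rightarrow>\<^sub>M RN N"
  unfolding RN_def by simp_all

lemma fst_in_bdry: "x \<in> space (RN N) \<Longrightarrow> fst x \<in> space (bdry N)"
  by (rule measurable_space [OF measurable_fst_RN])

lemma sqdist_measurable [measurable (raw)]:
  assumes [measurable]: "f \<in> M \<rightarrow>\<^sub>M RN N" "g \<in> M \<rightarrow>\<^sub>M RN N"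
  shows "(\<lambda>w. sqdist N (f w) (g w)) \<in> borel_measurable M"
proof -
  have [measurable]: "(\<lambda>w. fst (f w) i) \<in> borel_measurable M" "(\<lambda>w. fst (g w) i) \<in> borel_measurable M"
    if "i \<in> {..<N-1}" for i
    using that by (auto intro: measurable_bdry_comp)
  show ?thesis unfolding sqdist_def by measurable
qed

lemma Gam_measurable [measurable (raw)]:
  assumes [measurable]: "f \<in> M \<rightarrow>\<^sub>M RN N" "g \<in> M \<rightarrow>\<^sub>M RN N" "h \<in> borel_measurable M"
  shows "(\<lambda>w. Gam N (f w) (g w) (h w)) \<in> borel_measurable M"
  unfolding Gam_def by measurable

lemma Gk_measurable [measurable (raw)]:
  assumes [measurable]: "f \<in> M \<rightarrow>\<^sub>M RN N" "g \<in> M \<rightarrow>\<^sub>M RN N" "h \<in> borel_measurable M"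
  shows "(\<lambda>w. Gk N (f w) (g w) (h w)) \<in> borel_measurable M"
  unfolding Gk_def by measurable

lemma Ball_sets [measurable]: "Ball N x r \<in> sets (RN N)" if "x \<in> space (RN N)"
  using that unfolding Ball_def by measurable

lemma Dset_sets [measurable]: "Dset N \<in> sets (RN N)"
  unfolding Dset_eq by measurable

lemma heat_prod_measurable [measurable (raw)]:
  assumes [measurable]: "f \<in> M \<rightarrow>\<^sub>M bdry N" "g \<in> M \<rightarrow>\<^sub>M bdry N" "h \<in> borel_measurable M"
  shows "(\<lambda>w. heat_prod (N - 1) (f w) (g w) (h w)) \<in> borel_measurable M"
proof -
  have [measurable]: "(\<lambda>w. f w i) \<in> borel_measurable M" "(\<lambda>w. g w i) \<in> borel_measurable M"
    if "i \<in> {..<N-1}" for i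
    using that by (auto intro: measurable_bdry_comp)
  show ?thesis unfolding heat_prod_def by measurable
qed

lemma nn_integral_bdry_prod:
  assumes "\<And>i. i < N - 1 \<Longrightarrow> f i \<in> borel_measurable lborel"
  shows "(\<integral>\<^sup>+ y. (\<Prod>i<N-1. f i (y i)) \<partial>bdry N) = (\<Prod>i<N-1. \<integral>\<^sup>+ y. f i y \<partial>lborel)"
  unfolding bdry_def
  using product_sigma_finite.product_nn_integral_prod [OF product_sigma_finite_lborel, of "{..<N-1}" f] assms by auto

lemma nn_integral_heat_prod_semigroup:
  assumes "0 < s" "0 < t"
  shows "(\<integral>\<^sup>+ y. ennreal (heat_prod (N - 1) x y t) * ennreal (heat_prod (N - 1) y z s) \<partial>bdry N)
    = ennreal (heat_prod (N - 1) x z (t + s))"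
proof -
  have "(\<integral>\<^sup>+ y. ennreal (heat_prod (N - 1) x y t) * ennreal (heat_prod (N - 1) y z s) \<partial>bdry N)
     = (\<integral>\<^sup>+ y. (\<Prod>i<N-1. ennreal (heat1 t (x i - y i)) * ennreal (heat1 s (y i - z i))) \<partial>bdry N)"
    by (simp add: heat_prod_def prod.distrib prod_ennreal)
  also have "\<dots> = (\<Prod>i<N-1. ennreal (heat1 (t + s) (x i - z i)))"
    by (subst nn_integral_bdry_prod) (simp_all add: nn_integral_heat1_semigroup assms)
  finally show ?thesis by (simp add: heat_prod_def prod_ennreal)
qed

lemma nn_integral_Gam:
  assumes "N \<ge> 1" "0 < t" "x \<in> space (RN N)"
  shows "(\<integral>\<^sup>+ y. ennreal (Gam N x y t) \<partial>RN N) = 1"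
proof -
  have [measurable]: "fst x \<in> space (bdry N)" using assms by (simp_all add: fst_in_bdry)
  have "(\<integral>\<^sup>+ y. ennreal (Gam N x y t) \<partial>RN N)
      = (\<integral>\<^sup>+ y. ennreal (heat_prod (N - 1) (fst x) (fst y) t * heat1 t (snd x - snd y)) \<partial>(bdry N \<Otimes>\<^sub>M lborel))"
    using assms by (simp add: Gam_eq_heat_prod RN_def)
  also have "\<dots> = (\<integral>\<^sup>+ y'. \<integral>\<^sup>+ r. ennreal (heat_prod (N - 1) (fst x) y' t) * ennreal (heat1 t (snd x - r)) \<partial>lborel \<partial>bdry N)"
    by (subst lborel.nn_integral_fst [symmetric]) (measurable, simp add: ennreal_mult)
  also have "\<dots> = (\<integral>\<^sup>+ y'. ennreal (heat_prod (N - 1) (fst x) y' t) \<partial>bdry N)"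
    using assms by (simp add: nn_integral_cmult nn_integral_heat1_translate)
  also have "\<dots> = (\<integral>\<^sup>+ y. (\<Prod>i<N-1. ennreal (heat1 t (fst x i - y i))) \<partial>bdry N)"
    by (simp add: heat_prod_def prod_ennreal)
  also have "\<dots> = 1"
    by (subst nn_integral_bdry_prod) (simp_all add: nn_integral_heat1_translate assms)
  finally show ?thesis .
qed

section \<open>The reflected kernel and its composition along the boundary\<close>

lemma Gam_nonneg [simp]: "0 \<le> Gam N x y t"
  by (simp add: Gam_def)

lemma Gk_nonneg [simp]: "0 \<le> Gk N x y t"
  by (simp add: Gk_def)

lemma Gam_le_Gk: "Gam N x y t \<le> Gk N x y t"
  by (simp add: Gk_def)

text \<open>Within the half space the reflection of y is at least as far from x as y is, so the
  image term is at most the direct one.\<close>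

lemma Gk_le_Gam:
  assumes "0 \<le> snd x" "0 \<le> snd y" "0 < t"
  shows "Gk N x y t \<le> 2 * Gam N x y t"
proof -
  have "(snd x - snd y)\<^sup>2 \<le> (snd x + snd y)\<^sup>2"
    using assms by (simp add: power2_eq_square algebra_simps)
  then have "sqdist N x y \<le> sqdist N x (fst y, - snd y)" by (simp add: sqdist_def)
  then have "Gam N x (fst y, - snd y) t \<le> Gam N x y t"
    using assms by (simp add: Gam_def divide_right_mono mult_left_mono)
  then show ?thesis by (simp add: Gk_def)
qed

text \<open>A source on the boundary is its own image; in \<open>Gk_from_bdry\<close> the target
  lies on the boundary and is equidistant from source and image. Either way the two terms coincide,
  hence the factor 2.\<close>

lemma Gk_to_bdry: "N \<ge> 1 \<Longrightarrow> 0 < t \<Longrightarrow> Gk N x (y, 0) t = 2 * heat_prod (N - 1) (fst x) y t * heat1 t (snd x)"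
  by (simp add: Gk_def Gam_eq_heat_prod)

lemma Gk_from_bdry: "N \<ge> 1 \<Longrightarrow> 0 < t \<Longrightarrow> Gk N (y, 0) z t = 2 * heat_prod (N - 1) y (fst z) t * heat1 t (snd z)"
  by (simp add: Gk_def Gam_eq_heat_prod)

text \<open>Only the tangential factors merge to time \<open>t + s\<close>. The normal factors keep
  their separate times and are left to \<open>heat1_mult_le\<close>.\<close>

lemma nn_integral_Gk_bdry_compose:
  assumes "N \<ge> 1" "0 < s" "0 < t" "x \<in> space (RN N)" "z \<in> space (RN N)"
  shows "(\<integral>\<^sup>+ y. ennreal (Gk N x (y, 0) t) * ennreal (Gk N (y, 0) z s) \<partial>bdry N)
    = ennreal (4 * heat_prod (N - 1) (fst x) (fst z) (t + s) * heat1 t (snd x) * heat1 s (snd z))"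
proof -
  have [measurable]: "fst x \<in> space (bdry N)" "fst z \<in> space (bdry N)"
    using assms by (simp_all add: fst_in_bdry)
  let ?c = "4 * heat1 t (snd x) * heat1 s (snd z)"
  have "ennreal (Gk N x (y, 0) t) * ennreal (Gk N (y, 0) z s)
     = ennreal ?c * (ennreal (heat_prod (N - 1) (fst x) y t) * ennreal (heat_prod (N - 1) y (fst z) s))" for y
  proof -
    have "Gk N x (y, 0) t * Gk N (y, 0) z s
       = ?c * (heat_prod (N - 1) (fst x) y t * heat_prod (N - 1) y (fst z) s)"
      using assms by (simp add: Gk_to_bdry Gk_from_bdry)
    then show ?thesis by (simp only: ennreal_mult [symmetric] Gk_nonneg heat_prod_nonneg heat1_nonneg mult_nonneg_nonneg zero_le_numeral)
  qed
  then have "(\<integral>\<^sup>+ y. ennreal (Gk N x (y, 0) t) * ennreal (Gk N (y, 0) z s) \<partial>bdry N)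
     = (\<integral>\<^sup>+ y. ennreal ?c *
          (ennreal (heat_prod (N - 1) (fst x) y t) * ennreal (heat_prod (N - 1) y (fst z) s)) \<partial>bdry N)"
    by simp
  also have "\<dots> = ennreal ?c * ennreal (heat_prod (N - 1) (fst x) (fst z) (t + s))"
    using assms by (subst nn_integral_cmult) (measurable, simp add: nn_integral_heat_prod_semigroup)
  also have "\<dots> = ennreal (?c * heat_prod (N - 1) (fst x) (fst z) (t + s))"
    by (rule ennreal_mult [symmetric]) auto
  finally show ?thesis by (simp add: mult_ac)
qed

text \<open>The exponents are compared by \<open>a\<^sup>2/t + b\<^sup>2/s \<ge> (a - b)\<^sup>2/(t + s)\<close>.\<close>

lemma heat1_mult_le:
  assumes "0 < s" "0 < t"
  shows "heat1 t a * heat1 s b \<le> sqrt ((t + s) / (4 * pi * t * s)) * heat1 (t + s) (a - b)"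
proof -
  have "a\<^sup>2 / t + b\<^sup>2 / s - (a - b)\<^sup>2 / (t + s) = (a * s + b * t)\<^sup>2 / (t * s * (t + s))"
    using assms by (simp add: divide_simps) (simp add: power2_eq_square algebra_simps)
  also have "\<dots> \<ge> 0" using assms by simp
  finally have le: "(a - b)\<^sup>2 / (t + s) \<le> a\<^sup>2 / t + b\<^sup>2 / s" by simp
  have quarter: "r / (4 * w) = 1 / 4 * (r / w)" for r w :: real by simp
  have mono: "X \<le> Y + Z \<Longrightarrow> 1 / 4 * X \<le> 1 / 4 * Y + 1 / 4 * Z" for X Y Z :: real by simp
  have "(a - b)\<^sup>2 / (4 * (t + s)) \<le> a\<^sup>2 / (4 * t) + b\<^sup>2 / (4 * s)"
    unfolding quarter by (rule mono [OF le])
  then have expo: "exp (- a\<^sup>2 / (4 * t)) * exp (- b\<^sup>2 / (4 * s)) \<le> exp (- (a - b)\<^sup>2 / (4 * (t + s)))"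
    by (simp add: exp_add [symmetric])
  have coef: "(4 * pi * t) powr (- 1 / 2) * (4 * pi * s) powr (- 1 / 2)
      = sqrt ((t + s) / (4 * pi * t * s)) * (4 * pi * (t + s)) powr (- 1 / 2)"
  proof -
    have "(4 * pi * r) powr (- 1 / 2) = sqrt (1 / (4 * pi * r))" if "0 < r" for r
      using that by (simp add: powr_minus powr_half_sqrt real_sqrt_divide inverse_eq_divide)
    moreover have "1 / (4 * pi * t) * (1 / (4 * pi * s)) = (t + s) / (4 * pi * t * s) * (1 / (4 * pi * (t + s)))"
      using assms by (simp add: divide_simps)
    ultimately show ?thesis
      using assms by (metis add_pos_pos real_sqrt_mult)
  qed
  have "((4 * pi * t) powr (- 1 / 2) * (4 * pi * s) powr (- 1 / 2))
      * (exp (- a\<^sup>2 / (4 * t)) * exp (- b\<^sup>2 / (4 * s)))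
    \<le> (sqrt ((t + s) / (4 * pi * t * s)) * (4 * pi * (t + s)) powr (- 1 / 2)) * exp (- (a - b)\<^sup>2 / (4 * (t + s)))"
    unfolding coef by (rule mult_left_mono [OF expo]) (use assms in simp)
  then show ?thesis
    using assms by (simp add: heat1_eq mult_ac)
qed

section \<open>The a priori bound on the free evolution\<close>

lemma sqdist_nonneg [simp]: "0 \<le> sqdist N x y"
  by (simp add: sqdist_def sum_nonneg)

lemma sqdist_commute: "sqdist N x y = sqdist N y x"
  by (simp add: sqdist_def power2_commute)

text \<open>The gap between the two sides is a perfect square over \<eta>. The parameter trades the
  loss in the width of a Gaussian against the cost of moving its centre.\<close>

lemma power2_diff_le_weighted:
  fixes a b c :: real
  assumes "0 < \<eta>"
  shows "(a - c)\<^sup>2 \<le> (1 + \<eta>) * (a - b)\<^sup>2 + (1 + 1 / \<eta>) * (b - c)\<^sup>2"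
proof -
  have "(1 + \<eta>) * (a - b)\<^sup>2 + (1 + 1 / \<eta>) * (b - c)\<^sup>2 - (a - c)\<^sup>2 = (\<eta> * (a - b) - (b - c))\<^sup>2 / \<eta>"
    using assms by (simp add: divide_simps) (simp add: power2_eq_square algebra_simps)
  also have "\<dots> \<ge> 0" using assms by simp
  finally show ?thesis by simp
qed

lemma sqdist_triangle_weighted:
  assumes "0 < \<eta>"
  shows "sqdist N x z \<le> (1 + \<eta>) * sqdist N x y + (1 + 1 / \<eta>) * sqdist N y z"
proof -
  have "sqdist N x z \<le> (\<Sum>i<N-1. (1 + \<eta>) * (fst x i - fst y i)\<^sup>2 + (1 + 1 / \<eta>) * (fst y i - fst z i)\<^sup>2)
     + ((1 + \<eta>) * (snd x - snd y)\<^sup>2 + (1 + 1 / \<eta>) * (snd y - snd z)\<^sup>2)"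
    unfolding sqdist_def by (intro add_mono sum_mono power2_diff_le_weighted assms)
  also have "\<dots> = (1 + \<eta>) * sqdist N x y + (1 + 1 / \<eta>) * sqdist N y z"
    by (simp add: sqdist_def sum.distrib sum_distrib_left distrib_left)
  finally show ?thesis .
qed

text \<open>The normal side \<open>A\<close> is left open because it is used twice: with an open
  interval for the cube around a ball, and with a half-open one for the boxes in
  \<open>nn_integral_gaussian_le\<close>.\<close>

lemma emeasure_RN_box:
  assumes "0 \<le> h" "A \<in> sets borel"
  shows "emeasure (RN N) (PiE {..<N-1} (\<lambda>i. {f i - h<..<f i + h}) \<times> A) = ennreal ((2 * h) ^ (N - 1)) * emeasure lborel A"
proof -
  have "emeasure (bdry N) (PiE {..<N-1} (\<lambda>i. {f i - h<..<f i + h})) = (\<Prod>i<N-1. emeasure lborel {f i - h<..<f i + h})"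
    unfolding bdry_def by (rule product_sigma_finite.emeasure_PiM [OF product_sigma_finite_lborel]) auto
  also have "\<dots> = ennreal ((2 * h) ^ (N - 1))"
    using assms by (simp add: ennreal_power)
  finally have "emeasure (bdry N) (PiE {..<N-1} (\<lambda>i. {f i - h<..<f i + h})) = ennreal ((2 * h) ^ (N - 1))" .
  moreover have "PiE {..<N-1} (\<lambda>i. {f i - h<..<f i + h}) \<in> sets (bdry N)"
    unfolding bdry_def by (rule sets_PiM_I_finite) auto
  ultimately show ?thesis
    using assms unfolding RN_def by (subst lborel.emeasure_pair_measure_Times) auto
qed

lemma sq_le_sqdist:
  shows "i < N - 1 \<Longrightarrow> (fst x i - fst y i)\<^sup>2 \<le> sqdist N x y" and "(snd x - snd y)\<^sup>2 \<le> sqdist N x y"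
proof -
  show "(snd x - snd y)\<^sup>2 \<le> sqdist N x y" by (simp add: sqdist_def sum_nonneg)
  show "(fst x i - fst y i)\<^sup>2 \<le> sqdist N x y" if "i < N - 1"
  proof -
    have "(fst x i - fst y i)\<^sup>2 \<le> (\<Sum>i<N-1. (fst x i - fst y i)\<^sup>2)"
      using that by (intro member_le_sum) auto
    then show ?thesis unfolding sqdist_def by (smt (verit) zero_le_power2)
  qed
qed

text \<open>The volume occurs on the right of the ball condition, so an upper estimate suffices and
  the circumscribed cube gives it. The price \<open>2 ^ N\<close> ends up in the constant
  \<open>C\<close> of the theorem.\<close>

lemma measure_Ball_le:
  assumes "N \<ge> 1" "0 < r"
  shows "measure (RN N) (Ball N x r) \<le> (2 * r) ^ N"
proof -
  let ?B = "PiE {..<N-1} (\<lambda>i. {fst x i - r<..<fst x i + r}) \<times> {snd x - r<..<snd x + r}"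
  have sub: "Ball N x r \<subseteq> ?B"
  proof
    fix y assume y: "y \<in> Ball N x r"
    have lt: "\<bar>a\<bar> < r" if "a\<^sup>2 \<le> sqdist N x y" for a
      using that y by (smt (verit) Ball_def mem_Collect_eq real_sqrt_abs real_sqrt_le_iff)
    have "\<bar>snd x - snd y\<bar> < r" "\<And>i. i < N - 1 \<Longrightarrow> \<bar>fst x i - fst y i\<bar> < r"
      by (auto intro!: lt sq_le_sqdist)
    moreover have "fst y \<in> PiE {..<N-1} (\<lambda>_. UNIV)"
      using y by (auto simp: Ball_def space_RN)
    ultimately show "y \<in> ?B"
      by (auto simp: mem_Times_iff PiE_iff abs_less_iff) (smt (verit))+
  qed
  have B: "?B \<in> sets (RN N)"
    unfolding RN_def bdry_def by (intro pair_measureI sets_PiM_I_finite) auto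
  have em: "emeasure (RN N) ?B = ennreal ((2 * r) ^ N)"
  proof -
    have "(2 * r) ^ N = (2 * r) ^ (N - 1) * (2 * r)"
      using assms by (metis One_nat_def Suc_pred less_eq_Suc_le power_Suc2)
    then show ?thesis using assms by (simp add: emeasure_RN_box ennreal_mult)
  qed
  have "emeasure (RN N) (Ball N x r) \<le> ennreal ((2 * r) ^ N)"
    using emeasure_mono [OF sub B] unfolding em .
  then show ?thesis unfolding measure_def using assms by (intro enn2real_leI) simp_all
qed

section \<open>Radon measures on the closed half space\<close>

lemma radon_on_D_sets: "radon_on_D N \<mu> \<Longrightarrow> sets \<mu> = sets (RN N)"
  unfolding radon_on_D_def by (erule conjunct1)

lemma radon_on_D_finite: "radon_on_D N \<mu> \<Longrightarrow> emeasure \<mu> (Ball N x r) < \<infinity>"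
  unfolding radon_on_D_def by (drule conjunct2, drule conjunct1, erule spec2)

lemma radon_on_D_null: "radon_on_D N \<mu> \<Longrightarrow> emeasure \<mu> (space (RN N) - Dset N) = 0"
  unfolding radon_on_D_def by (elim conjE)

lemma radon_on_D_sigma_finite:
  assumes "radon_on_D N \<mu>" shows "sigma_finite_measure \<mu>"
proof
  note S = radon_on_D_sets [OF assms] and fin = radon_on_D_finite [OF assms]
  define x :: pt where "x = ((\<lambda>i\<in>{..<N-1}. 0), 0)"
  have x: "x \<in> space (RN N)" by (simp add: x_def space_RN)
  let ?A = "range (\<lambda>n. Ball N x (real n))"
  have "\<Union>?A = space (RN N)"
    unfolding Ball_def using reals_Archimedean2 by blast
  moreover have "?A \<subseteq> sets \<mu>" unfolding S using Ball_sets [OF x] by blast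
  moreover have "\<forall>a\<in>?A. emeasure \<mu> a \<noteq> \<infinity>" using fin by (simp add: less_top)
  ultimately show "\<exists>A. countable A \<and> A \<subseteq> sets \<mu> \<and> \<Union>A = space \<mu> \<and> (\<forall>a\<in>A. emeasure \<mu> a \<noteq> \<infinity>)"
    unfolding sets_eq_imp_space_eq [OF S] by (intro exI [of _ ?A]) simp
qed

lemma radon_on_D_AE:
  assumes "radon_on_D N \<mu>" shows "AE z in \<mu>. z \<in> Dset N"
proof (rule AE_I)
  note S = radon_on_D_sets [OF assms]
  show "{z \<in> space \<mu>. z \<notin> Dset N} \<subseteq> space (RN N) - Dset N"
    unfolding sets_eq_imp_space_eq [OF S] by blast
  show "emeasure \<mu> (space (RN N) - Dset N) = 0" by (rule radon_on_D_null [OF assms])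
  show "space (RN N) - Dset N \<in> sets \<mu>" unfolding S using Dset_sets by blast
qed

lemma nn_integral_exp_sqdist:
  assumes "N \<ge> 1" "0 < \<tau>" "x \<in> space (RN N)"
  shows "(\<integral>\<^sup>+ w. ennreal (exp (- sqdist N x w / (4 * \<tau>))) \<partial>RN N) = ennreal ((4 * pi * \<tau>) powr (real N / 2))"
proof -
  have "exp (- sqdist N x w / (4 * \<tau>)) = (4 * pi * \<tau>) powr (real N / 2) * Gam N x w \<tau>" for w
    using assms by (simp add: Gam_def powr_minus field_simps)
  then have "(\<integral>\<^sup>+ w. ennreal (exp (- sqdist N x w / (4 * \<tau>))) \<partial>RN N)
     = (\<integral>\<^sup>+ w. ennreal ((4 * pi * \<tau>) powr (real N / 2)) * ennreal (Gam N x w \<tau>) \<partial>RN N)"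
    by (simp add: ennreal_mult)
  also have "\<dots> = ennreal ((4 * pi * \<tau>) powr (real N / 2))"
    using assms by (subst nn_integral_cmult) (measurable, simp add: nn_integral_Gam)
  finally show ?thesis .
qed

text \<open>Instead of covering by balls, average over the boxes \<open>Q z\<close> attached to the points \<open>z\<close>. They
  extend upwards in the last coordinate, so that points of \<open>Q z\<close> stay in the half space, where the
  ball condition is available.\<close>

lemma nn_integral_gaussian_le:
  fixes c T M :: real
  assumes N: "N \<ge> 1" and T: "0 < T" and c: "0 < c" and x: "x \<in> space (RN N)"
    and sf: "sigma_finite_measure \<mu>" and S: "sets \<mu> = sets (RN N)"
    and D: "AE z in \<mu>. z \<in> Dset N"
    and W[measurable]: "W \<in> borel_measurable \<mu>"
    and M: "\<And>w. w \<in> Dset N \<Longrightarrow> (\<integral>\<^sup>+ z\<in>Ball N w (sqrt T). W z \<partial>\<mu>) \<le> ennreal M"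
    and "0 \<le> M"
  shows "(\<integral>\<^sup>+ z. W z * ennreal (exp (- c * sqdist N x z / T)) \<partial>\<mu>)
    \<le> ennreal (exp c * (2 * pi * T / c) powr (real N / 2) / (2 ^ (N - 1) * sqrt (T / N) ^ N) * M)"
proof -
  interpret mu: sigma_finite_measure \<mu> by (rule sf)
  interpret rn: sigma_finite_measure "RN N" by (rule sigma_finite_RN)
  interpret P: pair_sigma_finite \<mu> "RN N" ..
  have sp: "space \<mu> = space (RN N)" using S by (rule sets_eq_imp_space_eq)
  \<comment> \<open>The side is chosen so that N coordinate differences of size at most h have
    squares adding up to at most T. A box \<open>Q z\<close> then stays within distance
    \<open>sqrt T\<close> of z.\<close>
  define h where "h = sqrt (T / N)"
  have h: "0 < h" "N * h\<^sup>2 = T" using N T by (auto simp: h_def)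
  define Q where "Q z w \<longleftrightarrow> (\<forall>i\<in>{..<N-1}. \<bar>fst w i - fst z i\<bar> < h) \<and> snd z \<le> snd w \<and> snd w < snd z + h" for z w :: pt
  define K where "K = 2 ^ (N - 1) * h ^ N"
  have K: "0 < K" using h by (simp add: K_def)
  have comp: "(\<lambda>p. fst (f p) i) \<in> borel_measurable L" if "f \<in> L \<rightarrow>\<^sub>M RN N" "i \<in> {..<N-1}" for f i and L :: "'x measure"
    using that by (intro measurable_bdry_comp) (auto intro: measurable_compose [OF _ measurable_fst_RN])
  have id_mu: "(\<lambda>z. z) \<in> \<mu> \<rightarrow>\<^sub>M RN N" by (simp add: measurable_cong_sets [OF S refl])
  have [measurable]: "(\<lambda>z. sqdist N x z) \<in> borel_measurable \<mu>"
    by (rule sqdist_measurable [OF measurable_const [OF x] id_mu])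
  have [measurable]: "Dset N \<in> sets \<mu>" by (simp add: S)
  have Q_pred: "Measurable.pred L (\<lambda>p. Q (f p) (g p))"
    if [measurable]: "f \<in> L \<rightarrow>\<^sub>M RN N" "g \<in> L \<rightarrow>\<^sub>M RN N" for f g and L :: "'x measure"
  proof -
    have [measurable]: "(\<lambda>p. fst (f p) i) \<in> borel_measurable L" "(\<lambda>p. fst (g p) i) \<in> borel_measurable L"
      if "i \<in> {..<N-1}" for i
      using that by (auto intro: comp)
    show ?thesis unfolding Q_def by measurable
  qed
  have Qm [measurable]: "Measurable.pred (\<mu> \<Otimes>\<^sub>M RN N) (\<lambda>p. Q (fst p) (snd p))"
    by (intro Q_pred measurable_snd measurable_compose [OF measurable_fst id_mu])
  have Qm1 [measurable]: "Measurable.pred (RN N) (Q z)" if "z \<in> space (RN N)" for z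
    by (rule Q_pred [OF measurable_const [OF that] measurable_ident_sets [OF refl]])
  have Qm2 [measurable]: "Measurable.pred \<mu> (\<lambda>z. Q z w)" if "w \<in> space (RN N)" for w
    by (rule Q_pred [OF id_mu measurable_const [OF that]])
  have Qvol: "emeasure (RN N) {w \<in> space (RN N). Q z w} = ennreal K" for z
  proof -
    have "{w \<in> space (RN N). Q z w} = PiE {..<N-1} (\<lambda>i. {fst z i - h<..<fst z i + h}) \<times> {snd z..<snd z + h}"
      by (simp add: Q_def space_RN PiE_iff abs_diff_less_iff mem_Times_iff set_eq_iff) blast
    moreover have "h ^ N = h ^ (N - 1) * h"
      using N by (metis One_nat_def Suc_pred less_eq_Suc_le power_Suc2)
    ultimately show ?thesis
      using h by (simp add: emeasure_RN_box K_def ennreal_mult [symmetric] power_mult_distrib)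
  qed
  \<comment> \<open>Strictness comes from the normal coordinate, because the tangential sum is empty
    for N = 1.\<close>
  have QT: "sqdist N z w < T" if "Q z w" for z w
  proof -
    have "(\<Sum>i<N-1. (fst z i - fst w i)^2) \<le> (\<Sum>i<N-1. h\<^sup>2)"
      using that h by (intro sum_mono) (auto simp: Q_def abs_le_square_iff [symmetric] abs_minus_commute intro: less_imp_le)
    moreover have "(snd z - snd w)\<^sup>2 < h\<^sup>2"
      using that h by (simp add: Q_def power2_commute [of "snd z"] power_strict_mono)
    ultimately have "sqdist N z w < real (N - 1) * h\<^sup>2 + h\<^sup>2"
      by (simp add: sqdist_def)
    also have "\<dots> = T" using h N by (simp add: of_nat_diff algebra_simps)
    finally show ?thesis .
  qed
  \<comment> \<open>Moving from z to a point w of its box costs |x - w|^2 \<le> 2 |x - z|^2 + 2T.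
    Half the decay rate survives, with the factor \<open>exp c\<close>; the time
    \<open>T / (2 * c)\<close> writes this as a heat kernel exponent of known total mass.\<close>
  define G where "G w = ennreal (exp c * exp (- sqdist N x w / (4 * (T / (2 * c)))))" for w
  have Gm [measurable]: "G \<in> borel_measurable (RN N)"
    unfolding G_def using x by measurable
  have E: "ennreal (exp (- c * sqdist N x z / T)) * ennreal K \<le> (\<integral>\<^sup>+ w. indicator {w. Q z w} w * G w \<partial>RN N)"
    if "z \<in> space \<mu>" for z
  proof -
    have [measurable]: "Measurable.pred (RN N) (Q z)" using that by (simp add: Qm1 sp)
    have "ennreal (exp (- c * sqdist N x z / T)) * ennreal K
        = (\<integral>\<^sup>+ w. ennreal (exp (- c * sqdist N x z / T)) * indicator {w \<in> space (RN N). Q z w} w \<partial>RN N)"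
      by (subst nn_integral_cmult_indicator) (auto simp: Qvol)
    also have "\<dots> \<le> (\<integral>\<^sup>+ w. indicator {w. Q z w} w * G w \<partial>RN N)"
    proof (intro nn_integral_mono)
      fix w
      have "exp (- c * sqdist N x z / T) \<le> exp c * exp (- sqdist N x w / (4 * (T / (2 * c))))" if "Q z w"
      proof -
        have "sqdist N x w \<le> 2 * sqdist N x z + 2 * T"
          using sqdist_triangle_weighted [of 1 N x w z] QT [OF that] by simp
        then have "c * sqdist N x w / T \<le> c * (2 * sqdist N x z + 2 * T) / T"
          using c T by (simp add: divide_right_mono)
        also have "\<dots> = 2 * (c * sqdist N x z / T) + 2 * c" using T by (simp add: field_simps)
        moreover have "- sqdist N x w / (4 * (T / (2 * c))) = - (1 / 2) * (c * sqdist N x w / T)"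
          using c T by (simp add: field_simps)
        moreover have "- c * sqdist N x z / T = - (c * sqdist N x z / T)" by simp
        ultimately have "- c * sqdist N x z / T \<le> c + - sqdist N x w / (4 * (T / (2 * c)))" by argo
        then show ?thesis unfolding exp_add [symmetric] by simp
      qed
      then show "ennreal (exp (- c * sqdist N x z / T)) * indicator {w \<in> space (RN N). Q z w} w
          \<le> indicator {w. Q z w} w * G w"
        by (auto simp: G_def indicator_def)
    qed
    finally show ?thesis .
  qed
  \<comment> \<open>For fixed w, the z with w in \<open>Q z\<close> lie in the ball about w. If w is
    outside the half space, no z in \<open>Dset N\<close> qualifies, since boxes extend upwards; the
    inserted indicator makes this usable.\<close>
  have inner: "(\<integral>\<^sup>+ z. W z * indicator (Dset N) z * indicator {w. Q z w} w \<partial>\<mu>) \<le> ennreal M"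
    if w: "w \<in> space (RN N)" for w
  proof (cases "w \<in> Dset N")
    case True
    have "(\<integral>\<^sup>+ z. W z * indicator (Dset N) z * indicator {w. Q z w} w \<partial>\<mu>) \<le> (\<integral>\<^sup>+ z\<in>Ball N w (sqrt T). W z \<partial>\<mu>)"
    proof (intro nn_integral_mono)
      fix z assume "z \<in> space \<mu>"
      then show "W z * indicator (Dset N) z * indicator {w. Q z w} w \<le> W z * indicator (Ball N w (sqrt T)) z"
        using QT [of z w] by (auto simp: indicator_def Ball_def sp sqdist_commute [of N w])
    qed
    with M [OF True] show ?thesis by order
  next
    case False
    then have "W z * indicator (Dset N) z * indicator {w. Q z w} w = 0" for z
      using w by (auto simp: indicator_def Q_def Dset_eq)
    then have "(\<integral>\<^sup>+ z. W z * indicator (Dset N) z * indicator {w. Q z w} w \<partial>\<mu>) = (\<integral>\<^sup>+ z. 0 \<partial>\<mu>)"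
      by (simp only:)
    then show ?thesis by simp
  qed
  have "(\<integral>\<^sup>+ z. W z * ennreal (exp (- c * sqdist N x z / T)) \<partial>\<mu>) * ennreal K
     = (\<integral>\<^sup>+ z. W z * indicator (Dset N) z * (ennreal (exp (- c * sqdist N x z / T)) * ennreal K) \<partial>\<mu>)"
  proof -
    have "(\<integral>\<^sup>+ z. W z * ennreal (exp (- c * sqdist N x z / T)) \<partial>\<mu>) * ennreal K
       = (\<integral>\<^sup>+ z. W z * ennreal (exp (- c * sqdist N x z / T)) * ennreal K \<partial>\<mu>)"
      by (rule nn_integral_multc [symmetric]) measurable
    also have "\<dots> = (\<integral>\<^sup>+ z. W z * indicator (Dset N) z * (ennreal (exp (- c * sqdist N x z / T)) * ennreal K) \<partial>\<mu>)"
      using D by (intro nn_integral_cong_AE) (auto simp: mult_ac elim!: AE_mp)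
    finally show ?thesis .
  qed
  also have "\<dots> \<le> (\<integral>\<^sup>+ z. W z * indicator (Dset N) z * (\<integral>\<^sup>+ w. indicator {w. Q z w} w * G w \<partial>RN N) \<partial>\<mu>)"
    by (intro nn_integral_mono mult_left_mono E) auto
  also have "\<dots> = (\<integral>\<^sup>+ z. (\<integral>\<^sup>+ w. W z * indicator (Dset N) z * (indicator {w. Q z w} w * G w) \<partial>RN N) \<partial>\<mu>)"
  proof (intro nn_integral_cong)
    fix z assume z: "z \<in> space \<mu>"
    have [measurable]: "Measurable.pred (RN N) (Q z)" using z by (simp add: Qm1 sp)
    show "W z * indicator (Dset N) z * (\<integral>\<^sup>+ w. indicator {w. Q z w} w * G w \<partial>RN N)
       = (\<integral>\<^sup>+ w. W z * indicator (Dset N) z * (indicator {w. Q z w} w * G w) \<partial>RN N)"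
      by (rule nn_integral_cmult [symmetric]) measurable
  qed
  also have "\<dots> = (\<integral>\<^sup>+ w. (\<integral>\<^sup>+ z. W z * indicator (Dset N) z * (indicator {w. Q z w} w * G w) \<partial>\<mu>) \<partial>RN N)"
    by (rule P.Fubini' [symmetric]) (measurable)
  also have "\<dots> = (\<integral>\<^sup>+ w. (\<integral>\<^sup>+ z. W z * indicator (Dset N) z * indicator {w. Q z w} w \<partial>\<mu>) * G w \<partial>RN N)"
  proof (intro nn_integral_cong)
    fix w assume w: "w \<in> space (RN N)"
    have [measurable]: "Measurable.pred \<mu> (\<lambda>z. Q z w)" using w by (rule Qm2)
    show "(\<integral>\<^sup>+ z. W z * indicator (Dset N) z * (indicator {w. Q z w} w * G w) \<partial>\<mu>)
      = (\<integral>\<^sup>+ z. W z * indicator (Dset N) z * indicator {w. Q z w} w \<partial>\<mu>) * G w"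
      by (subst nn_integral_multc [symmetric]) (measurable, simp add: mult_ac)
  qed
  also have "\<dots> \<le> (\<integral>\<^sup>+ w. ennreal M * G w \<partial>RN N)"
    by (intro nn_integral_mono mult_right_mono inner) auto
  also have "\<dots> = ennreal (M * (exp c * (2 * pi * T / c) powr (real N / 2)))"
  proof -
    have "(\<integral>\<^sup>+ w. G w \<partial>RN N) = ennreal (exp c) * ennreal ((4 * pi * (T / (2 * c))) powr (real N / 2))"
      unfolding G_def using N T c x
      by (subst nn_integral_exp_sqdist [symmetric]) (auto simp: ennreal_mult nn_integral_cmult)
    then show ?thesis using \<open>0 \<le> M\<close> by (simp add: nn_integral_cmult ennreal_mult mult.assoc mult.commute [of T])
  qed
  finally have fin: "(\<integral>\<^sup>+ z. W z * ennreal (exp (- c * sqdist N x z / T)) \<partial>\<mu>) * ennreal K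
      \<le> ennreal (M * (exp c * (2 * pi * T / c) powr (real N / 2)))" .
  have "(\<integral>\<^sup>+ z. W z * ennreal (exp (- c * sqdist N x z / T)) \<partial>\<mu>)
      = (\<integral>\<^sup>+ z. W z * ennreal (exp (- c * sqdist N x z / T)) \<partial>\<mu>) * ennreal K * ennreal (1 / K)"
    using K by (simp add: mult.assoc flip: ennreal_mult)
  also have "\<dots> \<le> ennreal (M * (exp c * (2 * pi * T / c) powr (real N / 2))) * ennreal (1 / K)"
    by (rule mult_right_mono [OF fin]) auto
  also have "\<dots> = ennreal (exp c * (2 * pi * T / c) powr (real N / 2) / (2 ^ (N - 1) * sqrt (T / N) ^ N) * M)"
    using K \<open>0 \<le> M\<close> by (simp add: K_def h_def mult_ac flip: ennreal_mult)
  finally show ?thesis .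
qed

text \<open>As t \<le> T, the exponent |x - z|^2/(4T) can be spent. With \<eta> = \<delta> in the
  weighted inequality, the share (1 - \<delta>)(1 + \<delta>) = 1 - \<delta>^2 of it pays for the
  weight in z_N, up to a term in x_N that vanishes on the boundary. The share \<delta>^2 is left as
  a Gaussian to integrate.\<close>

lemma half_space_exponent_le:
  assumes T: "0 < t" "t \<le> T" and \<delta>: "0 < \<delta>" "\<delta> < 1"
  shows "- sqdist N x z / (4 * t) \<le> (1 - \<delta>) / (4 * T) * (1 + 1 / \<delta>) * (snd x)\<^sup>2
    + (- ((1 - \<delta>) / (4 * T)) * (snd z)\<^sup>2 + - (\<delta>\<^sup>2 / 4) * sqdist N x z / T)"
proof -
  have "(1 - \<delta>) * ((snd z)\<^sup>2 - (1 + 1 / \<delta>) * (snd x)\<^sup>2) \<le> (1 - \<delta>) * ((1 + \<delta>) * sqdist N x z)"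
  proof (intro mult_left_mono)
    have "(snd z)\<^sup>2 \<le> (1 + \<delta>) * (snd z - snd x)\<^sup>2 + (1 + 1 / \<delta>) * (snd x)\<^sup>2"
      using power2_diff_le_weighted [OF \<delta>(1), of "snd z" 0 "snd x"] by simp
    moreover have "(1 + \<delta>) * (snd z - snd x)\<^sup>2 \<le> (1 + \<delta>) * sqdist N x z"
      using sq_le_sqdist(2) [of x z N] \<delta> by (simp add: power2_commute)
    ultimately show "(snd z)\<^sup>2 - (1 + 1 / \<delta>) * (snd x)\<^sup>2 \<le> (1 + \<delta>) * sqdist N x z" by linarith
  qed (use \<delta> in simp)
  then have "((1 - \<delta>) * ((snd z)\<^sup>2 - (1 + 1 / \<delta>) * (snd x)\<^sup>2)) / (4 * T) \<le> ((1 - \<delta>) * ((1 + \<delta>) * sqdist N x z)) / (4 * T)"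
    using T by (intro divide_right_mono) auto
  moreover have "((1 - \<delta>) * ((1 + \<delta>) * sqdist N x z)) / (4 * T) = sqdist N x z / (4 * T) - (\<delta>\<^sup>2 / 4) * sqdist N x z / T"
    using T by (simp add: field_simps power2_eq_square)
  moreover have "sqdist N x z / (4 * T) \<le> sqdist N x z / (4 * t)"
    using T by (intro divide_left_mono) auto
  moreover have "((1 - \<delta>) * ((snd z)\<^sup>2 - (1 + 1 / \<delta>) * (snd x)\<^sup>2)) / (4 * T)
      = (1 - \<delta>) / (4 * T) * (snd z)\<^sup>2 - (1 - \<delta>) / (4 * T) * (1 + 1 / \<delta>) * (snd x)\<^sup>2"
  proof -
    have "(a * (b - d * e)) / k = a / k * b - a / k * d * e" for a b d e k :: real
      by (simp add: right_diff_distrib diff_divide_distrib)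
    then show ?thesis .
  qed
  ultimately show ?thesis by (simp only: mult_minus_left minus_divide_left [symmetric])
qed

text \<open>What \<open>nn_integral_gaussian_le\<close> with c = \<delta>^2/4 leaves once the
  T^(N/2) of the Gaussian mass has cancelled against the box volume. The leading 2 stems from
  \<open>Gk_le_Gam\<close>.\<close>

definition Sop_bound_const :: "nat \<Rightarrow> real \<Rightarrow> real" where
  "Sop_bound_const N \<delta> = 2 * (4 * pi) powr (- real N / 2) * exp (\<delta>\<^sup>2 / 4) * (8 * pi / \<delta>\<^sup>2) powr (real N / 2)
     / (2 ^ (N - 1) * sqrt (1 / N) ^ N)"

text \<open>On the boundary the exponential factor is 1 and this is the decay t^(-N/2) that feeds
  the iteration. In the interior the factor grows with x_N, and only finiteness is drawn from
  it.\<close>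

lemma Sop_le:
  assumes N: "N \<ge> 1" and R: "radon_on_D N \<mu>" and T: "0 < t" "t \<le> T" and \<delta>: "0 < \<delta>" "\<delta> < 1"
    and M: "\<And>w. w \<in> Dset N \<Longrightarrow> (\<integral>\<^sup>+ z\<in>Ball N w (sqrt T). ennreal (exp (- ((1 - \<delta>) / (4 * T)) * (snd z)\<^sup>2)) \<partial>\<mu>) \<le> ennreal M"
    and "0 \<le> M" and x: "x \<in> Dset N"
  shows "Sop N \<mu> t x \<le> ennreal (Sop_bound_const N \<delta> * exp ((1 - \<delta>) / (4 * T) * (1 + 1 / \<delta>) * (snd x)\<^sup>2)
    * t powr (- real N / 2) * M)"
proof -
  have S: "sets \<mu> = sets (RN N)" by (rule radon_on_D_sets [OF R])
  have [measurable]: "snd \<in> borel_measurable \<mu>" by (simp add: measurable_cong_sets [OF S refl])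
  have xs: "x \<in> space (RN N)" using x by (simp add: Dset_eq)
  have id_mu: "(\<lambda>z. z) \<in> \<mu> \<rightarrow>\<^sub>M RN N" by (simp add: measurable_cong_sets [OF S refl])
  have [measurable]: "(\<lambda>z. sqdist N x z) \<in> borel_measurable \<mu>"
    by (rule sqdist_measurable [OF measurable_const [OF xs] id_mu])
  define c where "c = 2 * (4 * pi * t) powr (- real N / 2) * exp ((1 - \<delta>) / (4 * T) * (1 + 1 / \<delta>) * (snd x)\<^sup>2)"
  let ?W = "\<lambda>z::pt. ennreal (exp (- ((1 - \<delta>) / (4 * T)) * (snd z)\<^sup>2))"
  let ?E = "\<lambda>z. ennreal (exp (- (\<delta>\<^sup>2 / 4) * sqdist N x z / T))"
  have "Sop N \<mu> t x \<le> (\<integral>\<^sup>+ z. ennreal c * (?W z * ?E z) \<partial>\<mu>)"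
    unfolding Sop_def
  proof (rule nn_integral_mono_AE, rule AE_mp [OF radon_on_D_AE [OF R]], intro AE_I2 impI)
    fix z assume z: "z \<in> Dset N"
    have "Gk N x z t \<le> 2 * Gam N x z t"
      using x z T by (intro Gk_le_Gam) (auto simp: Dset_eq)
    also have "\<dots> = 2 * (4 * pi * t) powr (- real N / 2) * exp (- sqdist N x z / (4 * t))"
      by (simp add: Gam_def)
    also have "\<dots> \<le> 2 * (4 * pi * t) powr (- real N / 2) * (exp ((1 - \<delta>) / (4 * T) * (1 + 1 / \<delta>) * (snd x)\<^sup>2)
      * (exp (- ((1 - \<delta>) / (4 * T)) * (snd z)\<^sup>2) * exp (- (\<delta>\<^sup>2 / 4) * sqdist N x z / T)))"
      unfolding exp_add [symmetric]
      using half_space_exponent_le [OF T \<delta>, of N x z] by (intro mult_left_mono) simp_all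
    finally have "Gk N x z t \<le> c * (exp (- ((1 - \<delta>) / (4 * T)) * (snd z)\<^sup>2) * exp (- (\<delta>\<^sup>2 / 4) * sqdist N x z / T))"
      by (simp add: c_def mult.assoc)
    moreover have "0 \<le> c" by (simp add: c_def)
    ultimately show "ennreal (Gk N x z t) \<le> ennreal c * (?W z * ?E z)"
      by (simp only: ennreal_mult [symmetric] ennreal_leI exp_ge_zero mult_nonneg_nonneg)
  qed
  also have "\<dots> = ennreal c * (\<integral>\<^sup>+ z. ?W z * ?E z \<partial>\<mu>)"
    by (rule nn_integral_cmult) measurable
  also have "\<dots> \<le> ennreal c * ennreal (exp (\<delta>\<^sup>2 / 4) * (2 * pi * T / (\<delta>\<^sup>2 / 4)) powr (real N / 2) / (2 ^ (N - 1) * sqrt (T / N) ^ N) * M)"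
    using T \<delta> by (intro mult_left_mono nn_integral_gaussian_le N xs radon_on_D_sigma_finite [OF R] S radon_on_D_AE [OF R] M \<open>0 \<le> M\<close>) auto
  also have "\<dots> = ennreal (c * (exp (\<delta>\<^sup>2 / 4) * (2 * pi * T / (\<delta>\<^sup>2 / 4)) powr (real N / 2) / (2 ^ (N - 1) * sqrt (T / N) ^ N) * M))"
    using \<open>0 \<le> M\<close> T by (intro ennreal_mult [symmetric]) (auto simp: c_def)
  also have "c * (exp (\<delta>\<^sup>2 / 4) * (2 * pi * T / (\<delta>\<^sup>2 / 4)) powr (real N / 2) / (2 ^ (N - 1) * sqrt (T / N) ^ N) * M)
    = Sop_bound_const N \<delta> * exp ((1 - \<delta>) / (4 * T) * (1 + 1 / \<delta>) * (snd x)\<^sup>2) * t powr (- real N / 2) * M"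
  proof -
    have pos: "0 < T" using T by simp
    have 1: "(2 * pi * T / (\<delta>\<^sup>2 / 4)) powr (real N / 2) = (8 * pi / \<delta>\<^sup>2) powr (real N / 2) * T powr (real N / 2)"
      using pos by (subst powr_mult [symmetric]) (auto simp: mult_ac)
    have 2: "sqrt (T / N) ^ N = sqrt (1 / N) ^ N * T powr (real N / 2)"
    proof -
      have "T powr (real N / 2) = sqrt T ^ N"
        using pos by (simp add: powr_half_sqrt [symmetric] powr_realpow [symmetric] powr_powr)
      then show ?thesis by (simp add: real_sqrt_divide power_divide)
    qed
    have 3: "(4 * pi * t) powr (- real N / 2) = (4 * pi) powr (- real N / 2) * t powr (- real N / 2)"
      using T by (subst powr_mult [symmetric]) auto
    have "T powr (real N / 2) \<noteq> 0" using pos by simp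
    then show ?thesis unfolding c_def 1 2 3 Sop_bound_const_def by (simp add: mult_ac)
  qed
  finally show ?thesis .
qed

lemma Sop_bound_const_pos: "N \<ge> 1 \<Longrightarrow> 0 < \<delta> \<Longrightarrow> 0 < Sop_bound_const N \<delta>"
  by (simp add: Sop_bound_const_def)

section \<open>Continuity of the free evolution\<close>

text \<open>Pratt's lemma: dominated convergence with a varying dominating sequence. Fatou's lemma is
  applied to \<open>u n\<close> and to \<open>v n - u n\<close>.\<close>

lemma nn_integral_dominated_convergence_varying:
  fixes u v :: "nat \<Rightarrow> 'a \<Rightarrow> ennreal"
  assumes [measurable]: "\<And>n. u n \<in> borel_measurable M" "\<And>n. v n \<in> borel_measurable M"
      "u' \<in> borel_measurable M" "v' \<in> borel_measurable M"
    and le: "\<And>n. AE x in M. u n x \<le> v n x"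
    and u: "AE x in M. (\<lambda>n. u n x) \<longlonglongrightarrow> u' x" and v: "AE x in M. (\<lambda>n. v n x) \<longlonglongrightarrow> v' x"
    and lim: "(\<lambda>n. \<integral>\<^sup>+ x. v n x \<partial>M) \<longlonglongrightarrow> (\<integral>\<^sup>+ x. v' x \<partial>M)" and fin: "(\<integral>\<^sup>+ x. v' x \<partial>M) < \<infinity>"
  shows "(\<lambda>n. \<integral>\<^sup>+ x. u n x \<partial>M) \<longlonglongrightarrow> (\<integral>\<^sup>+ x. u' x \<partial>M)"
proof -
  define a where "a n = (\<integral>\<^sup>+ x. u n x \<partial>M)" for n
  define b where "b n = (\<integral>\<^sup>+ x. v n x - u n x \<partial>M)" for n
  define a' where "a' = (\<integral>\<^sup>+ x. u' x \<partial>M)"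
  define b' where "b' = (\<integral>\<^sup>+ x. v' x - u' x \<partial>M)"
  have le_all: "AE x in M. \<forall>n. u n x \<le> v n x" using le by (simp add: AE_all_countable)
  have le': "AE x in M. u' x \<le> v' x"
    using le_all u v by eventually_elim (meson LIMSEQ_le)
  have fin': "AE x in M. v' x \<noteq> \<infinity>" using fin by (intro nn_integral_PInf_AE) auto
  have ab: "a n + b n = (\<integral>\<^sup>+ x. v n x \<partial>M)" for n
    unfolding a_def b_def using le [of n]
    by (subst nn_integral_add [symmetric]) (auto intro!: nn_integral_cong_AE elim!: AE_mp simp: add_diff_inverse_ennreal)
  have ab': "a' + b' = (\<integral>\<^sup>+ x. v' x \<partial>M)"
    unfolding a'_def b'_def using le'
    by (subst nn_integral_add [symmetric]) (auto intro!: nn_integral_cong_AE elim!: AE_mp simp: add_diff_inverse_ennreal)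
  have a_le: "a' \<le> liminf a"
  proof -
    have "a' = (\<integral>\<^sup>+ x. liminf (\<lambda>n. u n x) \<partial>M)"
      unfolding a'_def by (intro nn_integral_cong_AE, use u in eventually_elim) (simp add: lim_imp_Liminf)
    also have "\<dots> \<le> liminf a" unfolding a_def by (rule nn_integral_liminf) measurable
    finally show ?thesis .
  qed
  have b_le: "b' \<le> liminf b"
  proof -
    have "AE x in M. (\<lambda>n. v n x - u n x) \<longlonglongrightarrow> v' x - u' x"
      using u v fin' by eventually_elim (intro tendsto_diff_ennreal_general, auto)
    then have "AE x in M. v' x - u' x = liminf (\<lambda>n. v n x - u n x)"
      by eventually_elim (simp add: lim_imp_Liminf)
    then have "b' = (\<integral>\<^sup>+ x. liminf (\<lambda>n. v n x - u n x) \<partial>M)"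
      unfolding b'_def by (rule nn_integral_cong_AE)
    also have "\<dots> \<le> liminf b" unfolding b_def by (rule nn_integral_liminf) measurable
    finally show ?thesis .
  qed
  have "limsup a \<le> a'"
  proof -
    \<comment> \<open>Two nested subsequences realize \<open>limsup a\<close> and then the lower
      limit of b along the first one. Their limits add up to \<open>a' + b'\<close>, so Fatou for b,
      after cancelling the finite \<open>b'\<close>, yields the upper bound for a.\<close>
    obtain r where r: "strict_mono r" "(a \<circ> r) \<longlonglongrightarrow> limsup a" using limsup_subseq_lim by blast
    obtain s where s: "strict_mono s" "((b \<circ> r) \<circ> s) \<longlonglongrightarrow> liminf (b \<circ> r)" using liminf_subseq_lim by blast
    have "((a \<circ> r) \<circ> s) \<longlonglongrightarrow> limsup a" by (rule LIMSEQ_subseq_LIMSEQ [OF r(2) s(1)])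
    then have "(\<lambda>n. a (r (s n)) + b (r (s n))) \<longlonglongrightarrow> limsup a + liminf (b \<circ> r)"
      using s(2) by (intro tendsto_add) (auto simp: o_def)
    moreover have "(\<lambda>n. a (r (s n)) + b (r (s n))) \<longlonglongrightarrow> a' + b'"
      using LIMSEQ_subseq_LIMSEQ [OF lim strict_mono_o [OF r(1) s(1)]] by (simp add: ab ab' o_def)
    ultimately have "limsup a + liminf (b \<circ> r) = a' + b'" by (rule LIMSEQ_unique)
    moreover have "b' \<le> liminf (b \<circ> r)" using b_le liminf_subseq_mono [OF r(1), of b] by order
    ultimately have "limsup a + b' \<le> a' + b'" by (metis add_left_mono)
    moreover have "b' \<noteq> \<infinity>" using fin unfolding ab' [symmetric] by auto
    ultimately show ?thesis by (simp add: add.commute [of _ b'] ennreal_add_left_cancel_le)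
  qed
  then have "limsup a = a'" "liminf a = a'"
    using a_le Liminf_le_Limsup [of sequentially a] by (auto intro: antisym order_trans)
  then have "a \<longlonglongrightarrow> a'" by (simp add: tendsto_iff_Liminf_eq_Limsup)
  then show ?thesis by (simp add: a_def [abs_def] a'_def)
qed

text \<open>Continuity in \<open>is_solution\<close> refers to the product topology on
  \<open>nat \<Rightarrow> real\<close>, where evaluation at an index is continuous.\<close>

lemma tendsto_pt_coordinates:
  fixes X :: "nat \<Rightarrow> pt"
  assumes "X \<longlonglongrightarrow> x"
  shows "(\<lambda>n. fst (X n) i) \<longlonglongrightarrow> fst x i" and "(\<lambda>n. snd (X n)) \<longlonglongrightarrow> snd x"
proof -
  have c: "continuous_on UNIV (\<lambda>y::nat \<Rightarrow> real. y i)" by (rule continuous_on_product_coordinates)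
  show "(\<lambda>n. fst (X n) i) \<longlonglongrightarrow> fst x i"
    by (rule continuous_on_tendsto_compose [OF c tendsto_fst [OF assms]]) auto
  show "(\<lambda>n. snd (X n)) \<longlonglongrightarrow> snd x" by (rule tendsto_snd [OF assms])
qed

lemma tendsto_sqdist: "X \<longlonglongrightarrow> x \<Longrightarrow> (\<lambda>n. sqdist N (X n) z) \<longlonglongrightarrow> sqdist N x z"
  unfolding sqdist_def by (intro tendsto_intros tendsto_pt_coordinates)

lemma tendsto_Gk:
  assumes "X \<longlonglongrightarrow> x" "\<tau> \<longlonglongrightarrow> t" "0 < t"
  shows "(\<lambda>n. Gk N (X n) z (\<tau> n)) \<longlonglongrightarrow> Gk N x z t"
  unfolding Gk_def Gam_def using assms by (intro tendsto_intros tendsto_sqdist) auto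

text \<open>A slightly larger time absorbs a bounded displacement of the centre: \<eta> is chosen
  with (1 + \<eta>) t1 = t2. This gives a majorant at the fixed point x, integrable as long as
  S(t2)\<mu> is finite there.\<close>

lemma Gk_local_bound:
  assumes t: "0 < t" and t1: "0 < t1" "t1 < t2"
  shows "\<exists>C\<ge>0. \<forall>y \<tau> z. sqdist N y x \<le> 1 \<longrightarrow> t \<le> \<tau> \<longrightarrow> \<tau> \<le> t1 \<longrightarrow> Gk N y z \<tau> \<le> C * Gk N x z t2"
proof -
  define \<eta> where "\<eta> = t2 / t1 - 1"
  have \<eta>: "0 < \<eta>" "(1 + \<eta>) * t1 = t2" using t1 by (auto simp: \<eta>_def field_simps)
  define C where "C = (4 * pi * t) powr (- real N / 2) * (4 * pi * t2) powr (real N / 2) * exp ((1 + 1 / \<eta>) / (4 * t2))"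
  have "Gam N y z \<tau> \<le> C * Gam N x z t2"
    if y: "sqdist N y x \<le> 1" "t \<le> \<tau>" "\<tau> \<le> t1" for y \<tau> z
  proof -
    have "sqdist N z x \<le> (1 + \<eta>) * sqdist N z y + (1 + 1 / \<eta>) * sqdist N y x"
      by (rule sqdist_triangle_weighted [OF \<eta>(1)])
    also have "\<dots> \<le> (1 + \<eta>) * sqdist N z y + (1 + 1 / \<eta>) * 1"
      using y \<eta> by (intro add_left_mono mult_left_mono) auto
    finally have "sqdist N x z / (4 * t2) \<le> ((1 + \<eta>) * sqdist N y z + (1 + 1 / \<eta>)) / (4 * t2)"
      using t1 by (intro divide_right_mono) (auto simp: sqdist_commute)
    also have "\<dots> = sqdist N y z / (4 * t1) + (1 + 1 / \<eta>) / (4 * t2)"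
      unfolding add_divide_distrib using \<eta>(1) t1 by (simp flip: \<eta>(2))
    also have "sqdist N y z / (4 * t1) \<le> sqdist N y z / (4 * \<tau>)"
      using y t t1 by (intro divide_left_mono) auto
    finally have "exp (- sqdist N y z / (4 * \<tau>)) \<le> exp ((1 + 1 / \<eta>) / (4 * t2)) * exp (- sqdist N x z / (4 * t2))"
      by (simp flip: exp_add)
    moreover have "(4 * pi * \<tau>) powr (- real N / 2) \<le> (4 * pi * t) powr (- real N / 2)"
      using y t by (intro powr_mono2') auto
    ultimately have "Gam N y z \<tau> \<le> (4 * pi * t) powr (- real N / 2) *
        (exp ((1 + 1 / \<eta>) / (4 * t2)) * exp (- sqdist N x z / (4 * t2)))"
      unfolding Gam_def by (intro mult_mono) auto
    also have "\<dots> = C * Gam N x z t2"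
    proof -
      have "(4 * pi * t2) powr (real N / 2) * (4 * pi * t2) powr (- real N / 2) = 1"
        using t1 by (simp add: powr_add [symmetric])
      then show ?thesis unfolding C_def Gam_def by (simp add: mult_ac)
    qed
    finally show ?thesis .
  qed
  \<comment> \<open>The bound on \<open>Gam\<close> holds for every z, hence also at the reflected
    point with the same C.\<close>
  then show ?thesis
    by (intro exI [of _ C]) (auto simp: Gk_def distrib_left C_def intro!: add_mono)
qed

lemma measurable_ident_RN: "sets \<mu> = sets (RN N) \<Longrightarrow> (\<lambda>z. z) \<in> \<mu> \<rightarrow>\<^sub>M RN N"
  by (rule measurable_ident_sets)

lemma tendsto_Sop:
  assumes S: "sets \<mu> = sets (RN N)" and fin: "\<And>s. 0 < s \<Longrightarrow> s < T \<Longrightarrow> Sop N \<mu> s x < \<infinity>"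
    and X: "X \<longlonglongrightarrow> x" "\<And>n. X n \<in> space (RN N)" "x \<in> space (RN N)" and \<tau>: "\<tau> \<longlonglongrightarrow> t" and t: "0 < t" "t < T"
  shows "(\<lambda>n. Sop N \<mu> (\<tau> n) (X n)) \<longlonglongrightarrow> Sop N \<mu> t x"
proof -
  note id_mu = measurable_ident_RN [OF S]
  have m: "(\<lambda>z. ennreal (Gk N y z s)) \<in> borel_measurable \<mu>" if "y \<in> space (RN N)" for y s
    by (intro measurable_compose [OF _ measurable_ennreal] Gk_measurable measurable_const that id_mu) simp_all
  \<comment> \<open>The third points of (t, T): t1 bounds the times \<tau> n from some n on, and t2
    leaves room for the dominating kernel while S(t2)\<mu> is still finite.\<close>
  define t1 where "t1 = (2 * t + T) / 3"
  define t2 where "t2 = (t + 2 * T) / 3"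
  have tt: "t < t1" "t1 < t2" "t2 < T" "0 < t1" "0 < t2" using t by (auto simp: t1_def t2_def field_simps)
  obtain C where C: "0 \<le> C" "\<And>y s z. sqdist N y x \<le> 1 \<Longrightarrow> t / 2 \<le> s \<Longrightarrow> s \<le> t1 \<Longrightarrow> Gk N y z s \<le> C * Gk N x z t2"
    using Gk_local_bound [of "t / 2" t1 t2 N x] t tt by auto
  have "\<forall>\<^sub>F n in sequentially. sqdist N (X n) x < 1"
    using tendsto_sqdist [OF X(1), of N x] by (intro order_tendstoD(2)) (auto simp: sqdist_def)
  moreover have "\<forall>\<^sub>F n in sequentially. t / 2 < \<tau> n" "\<forall>\<^sub>F n in sequentially. \<tau> n < t1"
    by (rule order_tendstoD [OF \<tau>], use t tt in simp)+
  ultimately have "\<forall>\<^sub>F n in sequentially. sqdist N (X n) x \<le> 1 \<and> t / 2 \<le> \<tau> n \<and> \<tau> n \<le> t1"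
    by eventually_elim auto
  then obtain k where k: "\<And>n. k \<le> n \<Longrightarrow> sqdist N (X n) x \<le> 1 \<and> t / 2 \<le> \<tau> n \<and> \<tau> n \<le> t1"
    by (auto simp: eventually_sequentially)
  have "(\<lambda>n. Sop N \<mu> (\<tau> (n + k)) (X (n + k))) \<longlonglongrightarrow> Sop N \<mu> t x"
    unfolding Sop_def
  proof (rule nn_integral_dominated_convergence [where w = "\<lambda>z. ennreal C * ennreal (Gk N x z t2)"])
    show "AE z in \<mu>. ennreal (Gk N (X (n + k)) z (\<tau> (n + k))) \<le> ennreal C * ennreal (Gk N x z t2)" for n
      using C k [of "n + k"] by (auto simp: ennreal_mult [symmetric] intro!: ennreal_leI)
    have "(\<integral>\<^sup>+ z. ennreal C * ennreal (Gk N x z t2) \<partial>\<mu>) = ennreal C * Sop N \<mu> t2 x"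
      unfolding Sop_def by (intro nn_integral_cmult m X)
    also have "\<dots> < \<infinity>" using fin [of t2] tt by (simp add: ennreal_mult_less_top)
    finally show "(\<integral>\<^sup>+ z. ennreal C * ennreal (Gk N x z t2) \<partial>\<mu>) < \<infinity>" .
    show "AE z in \<mu>. (\<lambda>n. ennreal (Gk N (X (n + k)) z (\<tau> (n + k)))) \<longlonglongrightarrow> ennreal (Gk N x z t)"
      by (intro AE_I2 tendsto_ennrealI tendsto_Gk LIMSEQ_ignore_initial_segment X \<tau> t)
    show "(\<lambda>z. ennreal (Gk N (X (n + k)) z (\<tau> (n + k)))) \<in> borel_measurable \<mu>" for n
      by (rule m [OF X(2)])
    show "(\<lambda>z. ennreal (Gk N x z t)) \<in> borel_measurable \<mu>"
      by (rule m [OF X(3)])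
    show "(\<lambda>z. ennreal C * ennreal (Gk N x z t2)) \<in> borel_measurable \<mu>"
      by (intro borel_measurable_times_ennreal measurable_const m [OF X(3)]) simp
  qed
  then show ?thesis by (rule LIMSEQ_offset)
qed

section \<open>The boundary potential\<close>

text \<open>The Duhamel term with a free source f in place of u^p. Values in \<open>ennreal\<close>
  allow sources not yet known to be finite.\<close>

definition Psi :: "nat \<Rightarrow> ((nat \<Rightarrow> real) \<times> real \<Rightarrow> ennreal) \<Rightarrow> real \<Rightarrow> pt \<Rightarrow> ennreal" where
  "Psi N f t x = (\<integral>\<^sup>+ s. indicator {0<..<t} s * (\<integral>\<^sup>+ y. ennreal (Gk N x (y, 0) (t - s)) * f (y, s) \<partial>bdry N) \<partial>lborel)"

lemma Sop_measurable:
  assumes \<mu>: "sigma_finite_measure \<mu>" "sets \<mu> = sets (RN N)"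
    and [measurable]: "f \<in> M \<rightarrow>\<^sub>M RN N" "h \<in> borel_measurable M"
  shows "(\<lambda>w. Sop N \<mu> (h w) (f w)) \<in> borel_measurable M"
proof -
  interpret sigma_finite_measure \<mu> by (rule \<mu>)
  have [measurable]: "(\<lambda>q. snd q) \<in> M \<Otimes>\<^sub>M \<mu> \<rightarrow>\<^sub>M RN N"
    by (rule measurable_compose [OF measurable_snd measurable_ident_RN [OF \<mu>(2)]])
  show ?thesis unfolding Sop_def
    by (rule borel_measurable_nn_integral) (simp add: split_beta')
qed

lemma Psi_measurable:
  assumes [measurable]: "f \<in> borel_measurable (bdry N \<Otimes>\<^sub>M lborel)" "g \<in> M \<rightarrow>\<^sub>M RN N" "h \<in> borel_measurable M"
  shows "(\<lambda>w. Psi N f (h w) (g w)) \<in> borel_measurable M"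
proof -
  interpret bd: sigma_finite_measure "bdry N" by (rule sigma_finite_bdry)
  have [measurable]: "(\<lambda>q. \<integral>\<^sup>+ y. ennreal (Gk N (g (fst q)) (y, 0) (h (fst q) - snd q)) * f (y, snd q) \<partial>bdry N)
     \<in> borel_measurable (M \<Otimes>\<^sub>M lborel)"
    by (rule bd.borel_measurable_nn_integral) (simp add: split_beta')
  have ind: "(\<lambda>q. indicator {0<..<h (fst q)} (snd q) :: ennreal) = (\<lambda>q. if 0 < snd q \<and> snd q < h (fst q) then 1 else 0)"
    by (auto simp: fun_eq_iff indicator_def)
  have [measurable]: "(\<lambda>q. indicator {0<..<h (fst q)} (snd q) :: ennreal) \<in> borel_measurable (M \<Otimes>\<^sub>M lborel)"
    unfolding ind by measurable
  show ?thesis unfolding Psi_def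
    by (rule lborel.borel_measurable_nn_integral) (simp add: split_beta')
qed

text \<open>As one integral over a product measure, the potential is open to a single use of
  monotone or dominated convergence instead of one per variable.\<close>

lemma Psi_eq_pair:
  assumes [measurable]: "f \<in> borel_measurable (bdry N \<Otimes>\<^sub>M lborel)" and x [measurable]: "x \<in> space (RN N)"
  shows "Psi N f t x = (\<integral>\<^sup>+ q. indicator {0<..<t} (fst q) * (ennreal (Gk N x (snd q, 0) (t - fst q)) * f (snd q, fst q)) \<partial>(lborel \<Otimes>\<^sub>M bdry N))"
proof -
  interpret bd: sigma_finite_measure "bdry N" by (rule sigma_finite_bdry)
  have [measurable]: "(\<lambda>q. f (snd q, fst q)) \<in> borel_measurable (lborel \<Otimes>\<^sub>M bdry N)"
    by (rule measurable_compose [OF measurable_Pair [OF measurable_snd measurable_fst] assms(1)])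
  have "Psi N f t x = (\<integral>\<^sup>+ s. (\<integral>\<^sup>+ y. indicator {0<..<t} s * (ennreal (Gk N x (y, 0) (t - s)) * f (y, s)) \<partial>bdry N) \<partial>lborel)"
    unfolding Psi_def by (intro nn_integral_cong nn_integral_cmult [symmetric]) measurable
  also have "\<dots> = (\<integral>\<^sup>+ q. indicator {0<..<t} (fst q) * (ennreal (Gk N x (snd q, 0) (t - fst q)) * f (snd q, fst q)) \<partial>(lborel \<Otimes>\<^sub>M bdry N))"
  proof (subst bd.nn_integral_fst [symmetric])
    show "(\<lambda>q. indicator {0<..<t} (fst q) * (ennreal (Gk N x (snd q, 0) (t - fst q)) * f (snd q, fst q)))
        \<in> borel_measurable (lborel \<Otimes>\<^sub>M bdry N)"
      by measurable
  qed simp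
  finally show ?thesis .
qed

text \<open>If \<open>u \<le> 2 S \<mu>\<close> on the boundary, then \<open>u\<^sup>p \<le> fstar\<close> for \<open>a = N(p - 1)/2\<close> and a suitable \<open>B\<close>.
  Its boundary potential is explicit up to one time integral, in which \<open>s = t \<sigma>\<close> is substituted
  to make the domain of integration independent of \<open>t\<close>; this gives the kernel \<open>Hker\<close>.\<close>

definition fstar :: "nat \<Rightarrow> pt measure \<Rightarrow> real \<Rightarrow> real \<Rightarrow> (nat \<Rightarrow> real) \<times> real \<Rightarrow> ennreal" where
  "fstar N \<mu> B a = (\<lambda>q. ennreal (B * snd q powr (- a)) * Sop N \<mu> (snd q) (fst q, 0))"

definition Hker :: "nat \<Rightarrow> real \<Rightarrow> real \<Rightarrow> real \<Rightarrow> pt \<Rightarrow> real \<times> pt \<Rightarrow> ennreal" where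
  "Hker N B a t x q = indicator {0<..<1} (fst q) * ennreal (t * (B * (t * fst q) powr (- a) *
     (4 * heat_prod (N - 1) (fst x) (fst (snd q)) t * heat1 (t - t * fst q) (snd x) * heat1 (t * fst q) (snd (snd q)))))"

lemma fstar_measurable:
  assumes "sigma_finite_measure \<mu>" "sets \<mu> = sets (RN N)"
  shows "fstar N \<mu> B a \<in> borel_measurable (bdry N \<Otimes>\<^sub>M lborel)"
proof -
  have [measurable]: "(\<lambda>q. Sop N \<mu> (snd q) (fst q, 0)) \<in> borel_measurable (bdry N \<Otimes>\<^sub>M lborel)"
    by (rule Sop_measurable [OF assms]) measurable
  show ?thesis unfolding fstar_def by measurable
qed

lemma Hker_measurable:
  assumes "sets \<mu> = sets (RN N)" and x: "x \<in> space (RN N)"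
  shows "Hker N B a t x \<in> borel_measurable (lborel \<Otimes>\<^sub>M \<mu>)"
proof -
  have [measurable]: "(\<lambda>q. snd q) \<in> lborel \<Otimes>\<^sub>M \<mu> \<rightarrow>\<^sub>M RN N"
    by (rule measurable_compose [OF measurable_snd measurable_ident_RN [OF assms(1)]])
  have [measurable]: "fst x \<in> space (bdry N)" by (rule fst_in_bdry [OF x])
  show ?thesis unfolding Hker_def [abs_def] by measurable
qed

text \<open>The source is linear in \<mu>, so Tonelli brings the boundary integral inside, where
  \<open>nn_integral_Gk_bdry_compose\<close> evaluates it. The tangential times add up to (t - s) +
  s = t.\<close>

lemma nn_integral_Gk_fstar:
  assumes N: "N \<ge> 1" and \<mu>: "sigma_finite_measure \<mu>" "sets \<mu> = sets (RN N)" and B: "0 \<le> B"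
    and x: "x \<in> space (RN N)" and s: "0 < s" "s < t"
  shows "(\<integral>\<^sup>+ y. ennreal (Gk N x (y, 0) (t - s)) * fstar N \<mu> B a (y, s) \<partial>bdry N)
    = (\<integral>\<^sup>+ z. ennreal (B * s powr (- a) * (4 * heat_prod (N - 1) (fst x) (fst z) t * heat1 (t - s) (snd x) * heat1 s (snd z))) \<partial>\<mu>)"
proof -
  interpret bd: sigma_finite_measure "bdry N" by (rule sigma_finite_bdry)
  interpret mu: sigma_finite_measure \<mu> by (rule \<mu>)
  interpret P: pair_sigma_finite "bdry N" \<mu> ..
  have [measurable]: "(\<lambda>z. z) \<in> \<mu> \<rightarrow>\<^sub>M RN N" by (rule measurable_ident_RN [OF \<mu>(2)])
  have [measurable]: "(\<lambda>q. snd q) \<in> bdry N \<Otimes>\<^sub>M \<mu> \<rightarrow>\<^sub>M RN N"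
    by (rule measurable_compose [OF measurable_snd measurable_ident_RN [OF \<mu>(2)]])
  note x [measurable]
  let ?c = "ennreal (B * s powr (- a))"
  have "(\<integral>\<^sup>+ y. ennreal (Gk N x (y, 0) (t - s)) * fstar N \<mu> B a (y, s) \<partial>bdry N)
     = (\<integral>\<^sup>+ y. (\<integral>\<^sup>+ z. ?c * (ennreal (Gk N x (y, 0) (t - s)) * ennreal (Gk N (y, 0) z s)) \<partial>\<mu>) \<partial>bdry N)"
  proof (intro nn_integral_cong)
    fix y assume [measurable]: "y \<in> space (bdry N)"
    have [measurable]: "(\<lambda>z. ennreal (Gk N (y, 0) z s)) \<in> borel_measurable \<mu>" by measurable
    show "ennreal (Gk N x (y, 0) (t - s)) * fstar N \<mu> B a (y, s)
       = (\<integral>\<^sup>+ z. ?c * (ennreal (Gk N x (y, 0) (t - s)) * ennreal (Gk N (y, 0) z s)) \<partial>\<mu>)"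
      by (simp add: fstar_def Sop_def nn_integral_cmult mult.left_commute [of "ennreal (Gk N x (y, 0) (t - s))"])
  qed
  also have "\<dots> = (\<integral>\<^sup>+ z. (\<integral>\<^sup>+ y. ?c * (ennreal (Gk N x (y, 0) (t - s)) * ennreal (Gk N (y, 0) z s)) \<partial>bdry N) \<partial>\<mu>)"
    by (rule P.Fubini' [symmetric]) (simp add: split_beta')
  also have "\<dots> = (\<integral>\<^sup>+ z. ennreal (B * s powr (- a) * (4 * heat_prod (N - 1) (fst x) (fst z) t * heat1 (t - s) (snd x) * heat1 s (snd z))) \<partial>\<mu>)"
  proof (intro nn_integral_cong)
    fix z assume "z \<in> space \<mu>"
    then have z [measurable]: "z \<in> space (RN N)" using sets_eq_imp_space_eq [OF \<mu>(2)] by simp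
    have "(\<integral>\<^sup>+ y. ?c * (ennreal (Gk N x (y, 0) (t - s)) * ennreal (Gk N (y, 0) z s)) \<partial>bdry N)
       = ?c * (\<integral>\<^sup>+ y. ennreal (Gk N x (y, 0) (t - s)) * ennreal (Gk N (y, 0) z s) \<partial>bdry N)"
      by (rule nn_integral_cmult) measurable
    also have "\<dots> = ?c * ennreal (4 * heat_prod (N - 1) (fst x) (fst z) t * heat1 (t - s) (snd x) * heat1 s (snd z))"
      using nn_integral_Gk_bdry_compose [OF N s(1) _ x z, of "t - s"] s by simp
    finally show "(\<integral>\<^sup>+ y. ?c * (ennreal (Gk N x (y, 0) (t - s)) * ennreal (Gk N (y, 0) z s)) \<partial>bdry N)
      = ennreal (B * s powr (- a) * (4 * heat_prod (N - 1) (fst x) (fst z) t * heat1 (t - s) (snd x) * heat1 s (snd z)))"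
      using B by (simp add: ennreal_mult)
  qed
  finally show ?thesis .
qed

lemma Psi_fstar:
  assumes N: "N \<ge> 1" and \<mu>: "sigma_finite_measure \<mu>" "sets \<mu> = sets (RN N)" and B: "0 \<le> B"
    and x: "x \<in> space (RN N)" and t: "0 < t"
  shows "Psi N (fstar N \<mu> B a) t x = (\<integral>\<^sup>+ q. Hker N B a t x q \<partial>(lborel \<Otimes>\<^sub>M \<mu>))"
proof -
  interpret mu: sigma_finite_measure \<mu> by (rule \<mu>)
  define J where "J s z = ennreal (B * s powr (- a) * (4 * heat_prod (N - 1) (fst x) (fst z) t * heat1 (t - s) (snd x) * heat1 s (snd z)))" for s and z :: pt
  have [measurable]: "fst x \<in> space (bdry N)" by (rule fst_in_bdry [OF x])
  have [measurable]: "(\<lambda>z. z) \<in> \<mu> \<rightarrow>\<^sub>M RN N" by (rule measurable_ident_RN [OF \<mu>(2)])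
  have [measurable]: "(\<lambda>q. snd q) \<in> borel \<Otimes>\<^sub>M \<mu> \<rightarrow>\<^sub>M RN N"
    by (rule measurable_compose [OF measurable_snd measurable_ident_RN [OF \<mu>(2)]])
  have Jm [measurable]: "J s \<in> borel_measurable \<mu>" for s
    unfolding J_def [abs_def] by measurable
  have [measurable]: "(\<lambda>s. \<integral>\<^sup>+ z. J s z \<partial>\<mu>) \<in> borel_measurable borel"
    unfolding J_def by (rule mu.borel_measurable_nn_integral) (simp add: split_beta')
  have "Psi N (fstar N \<mu> B a) t x = (\<integral>\<^sup>+ s. indicator {0<..<t} s * (\<integral>\<^sup>+ z. J s z \<partial>\<mu>) \<partial>lborel)"
    unfolding Psi_def
  proof (intro nn_integral_cong)
    fix s
    show "indicator {0<..<t} s * (\<integral>\<^sup>+ y. ennreal (Gk N x (y, 0) (t - s)) * fstar N \<mu> B a (y, s) \<partial>bdry N)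
       = indicator {0<..<t} s * (\<integral>\<^sup>+ z. J s z \<partial>\<mu>)"
      using nn_integral_Gk_fstar [OF N \<mu> B x, of s t a] by (simp add: indicator_def J_def)
  qed
  also have "\<dots> = ennreal \<bar>t\<bar> * (\<integral>\<^sup>+ s. indicator {0<..<t} (0 + t * s) * (\<integral>\<^sup>+ z. J (0 + t * s) z \<partial>\<mu>) \<partial>lborel)"
    using t by (intro nn_integral_real_affine) auto
  also have "\<dots> = (\<integral>\<^sup>+ s. \<integral>\<^sup>+ z. Hker N B a t x (s, z) \<partial>\<mu> \<partial>lborel)"
  proof -
    have "ennreal t * (indicator {0<..<t} (t * s) * (\<integral>\<^sup>+ z. J (t * s) z \<partial>\<mu>)) = (\<integral>\<^sup>+ z. Hker N B a t x (s, z) \<partial>\<mu>)" for s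
    proof -
      have i: "indicator {0<..<t} (t * s) = (indicator {0<..<1} s :: ennreal)"
        using t by (auto simp: indicator_def zero_less_mult_iff)
      have "Hker N B a t x (s, z) = indicator {0<..<1} s * ennreal t * J (t * s) z" for z
        unfolding Hker_def J_def using t B by (simp add: ennreal_mult mult.assoc)
      then have "(\<integral>\<^sup>+ z. Hker N B a t x (s, z) \<partial>\<mu>) = indicator {0<..<1} s * ennreal t * (\<integral>\<^sup>+ z. J (t * s) z \<partial>\<mu>)"
        by (simp add: nn_integral_cmult)
      then show ?thesis unfolding i by (simp add: mult_ac)
    qed
    then show ?thesis using t by (subst nn_integral_cmult [symmetric]) auto
  qed
  also have "\<dots> = (\<integral>\<^sup>+ q. Hker N B a t x q \<partial>(lborel \<Otimes>\<^sub>M \<mu>))"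
    by (rule mu.nn_integral_fst) (rule Hker_measurable [OF \<mu>(2) x])
  finally show ?thesis .
qed

text \<open>Euler's B(1/2 - a, 1/2). The exponent at 0 joins -a from the source with -1/2 from
  \<open>heat1_mult_le\<close>.\<close>

definition beta_int :: "real \<Rightarrow> ennreal" where
  "beta_int a = (\<integral>\<^sup>+ \<sigma>. indicator {0<..<1} \<sigma> * ennreal (\<sigma> powr (- a - 1 / 2) * (1 - \<sigma>) powr (- 1 / 2)) \<partial>lborel)"

lemma nn_integral_powr_finite:
  assumes "- 1 < r"
  shows "(\<integral>\<^sup>+ \<sigma>. ennreal (\<sigma> powr r) * indicator {0..1} \<sigma> \<partial>lborel) < \<infinity>"
proof -
  have "((\<lambda>x::real. x powr r) has_integral (1 powr (r + 1) / (r + 1))) {0..1}"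
    using assms by (intro has_integral_powr_from_0) auto
  then show ?thesis by (subst nn_integral_has_integral_lebesgue') auto
qed

lemma beta_int_finite:
  assumes "0 \<le> a" "a < 1 / 2"
  shows "beta_int a < \<infinity>"
proof -
  let ?f = "\<lambda>\<sigma>::real. ennreal (\<sigma> powr (- a - 1 / 2)) * indicator {0..1} \<sigma>"
  let ?g = "\<lambda>\<sigma>::real. ennreal (\<sigma> powr (- 1 / 2)) * indicator {0..1} \<sigma>"
  have "beta_int a \<le> (\<integral>\<^sup>+ \<sigma>. 2 * (?f \<sigma> + ?g (1 + (- 1) * \<sigma>)) \<partial>lborel)"
    unfolding beta_int_def
  proof (intro nn_integral_mono)
    fix \<sigma> :: real
    have "\<sigma> powr (- a - 1 / 2) * (1 - \<sigma>) powr (- 1 / 2) \<le> 2 * (\<sigma> powr (- a - 1 / 2) + (1 - \<sigma>) powr (- 1 / 2))"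
      if \<sigma>: "0 < \<sigma>" "\<sigma> < 1"
    proof -
      \<comment> \<open>On each half of (0,1) the factor that is regular there is at most 2, as both
        exponents are at least -1; this uses a < 1/2.\<close>
      have half: "r powr b \<le> 2" if r: "1 / 2 \<le> r" and b: "- 1 \<le> b" "b \<le> 0" for r b :: real
      proof -
        have "r powr b \<le> (1 / 2) powr b" using r b by (intro powr_mono2') auto
        also have "\<dots> \<le> (1 / 2) powr (- 1)" using b by (intro powr_mono') auto
        finally show ?thesis by (simp add: powr_minus)
      qed
      show ?thesis
      proof (cases "\<sigma> \<le> 1 / 2")
        case True
        then have "\<sigma> powr (- a - 1 / 2) * (1 - \<sigma>) powr (- 1 / 2) \<le> \<sigma> powr (- a - 1 / 2) * 2"
          by (intro mult_left_mono half) auto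
        then show ?thesis by (smt (verit) powr_ge_zero)
      next
        case False
        then have "\<sigma> powr (- a - 1 / 2) * (1 - \<sigma>) powr (- 1 / 2) \<le> 2 * (1 - \<sigma>) powr (- 1 / 2)"
          using assms by (intro mult_right_mono half) auto
        then show ?thesis by (smt (verit) powr_ge_zero)
      qed
    qed
    then show "indicator {0<..<1} \<sigma> * ennreal (\<sigma> powr (- a - 1 / 2) * (1 - \<sigma>) powr (- 1 / 2)) \<le> 2 * (?f \<sigma> + ?g (1 + (- 1) * \<sigma>))"
    proof (cases "\<sigma> \<in> {0<..<1}")
      case True
      have "2 * (?f \<sigma> + ?g (1 + (- 1) * \<sigma>)) = ennreal (2 * (\<sigma> powr (- a - 1 / 2) + (1 - \<sigma>) powr (- 1 / 2)))"
        using True by (simp add: ennreal_mult ennreal_plus)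
      then show ?thesis
        using True \<open>0 < \<sigma> \<Longrightarrow> \<sigma> < 1 \<Longrightarrow> _\<close> by (simp add: ennreal_leI del: ennreal_plus)
    qed simp
  qed
  also have "\<dots> = 2 * ((\<integral>\<^sup>+ \<sigma>. ?f \<sigma> \<partial>lborel) + (\<integral>\<^sup>+ \<sigma>. ?g (1 + (- 1) * \<sigma>) \<partial>lborel))"
    by (simp add: nn_integral_cmult nn_integral_add)
  also have "(\<integral>\<^sup>+ \<sigma>. ?g (1 + (- 1) * \<sigma>) \<partial>lborel) = (\<integral>\<^sup>+ \<sigma>. ?g \<sigma> \<partial>lborel)"
    by (subst (2) nn_integral_real_affine [where c = "- 1" and t = 1]) auto
  also have "2 * ((\<integral>\<^sup>+ \<sigma>. ?f \<sigma> \<partial>lborel) + (\<integral>\<^sup>+ \<sigma>. ?g \<sigma> \<partial>lborel)) < \<infinity>"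
    using nn_integral_powr_finite [of "- a - 1 / 2"] nn_integral_powr_finite [of "- 1 / 2"] assms
    by (simp add: ennreal_mult_less_top)
  finally show ?thesis .
qed

text \<open>A majorant of \<open>Hker\<close> in product form, so that its integral splits into
  \<open>beta_int a\<close> and S(t)\<mu>. The constant is the 4 of \<open>Hker\<close> times 1/(2
  sqrt \<pi>) from \<open>heat1_mult_le\<close>; the power of t is 1 - a - 1/2.\<close>

definition Hdom :: "nat \<Rightarrow> real \<Rightarrow> real \<Rightarrow> real \<Rightarrow> pt \<Rightarrow> real \<times> pt \<Rightarrow> ennreal" where
  "Hdom N B a t x q = ennreal (2 / sqrt pi * B * t powr (1 / 2 - a)) *
     (indicator {0<..<1} (fst q) * ennreal (fst q powr (- a - 1 / 2) * (1 - fst q) powr (- 1 / 2)) * ennreal (Gk N x (snd q) t))"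

text \<open>\<open>heat1_mult_le\<close> turns the two normal factors into one kernel at time t,
  which joins the tangential factor to form \<open>Gam\<close> again.\<close>

lemma Hker_le_Hdom:
  assumes N: "N \<ge> 1" and t: "0 < t" and B: "0 \<le> B"
  shows "Hker N B a t x q \<le> Hdom N B a t x q"
proof (cases "fst q \<in> {0<..<1}")
  case True
  define \<sigma> where "\<sigma> = fst q"
  let ?z = "snd q"
  have \<sigma>: "0 < \<sigma>" "\<sigma> < 1" using True by (auto simp: \<sigma>_def)
  have ts: "0 < t * \<sigma>" "0 < t - t * \<sigma>" using \<sigma> t by auto
  define P where "P = heat_prod (N - 1) (fst x) (fst ?z) t"
  have root: "sqrt (t / (4 * pi * (t - t * \<sigma>) * (t * \<sigma>))) = 1 / (2 * sqrt pi) * t powr (- 1 / 2) * (\<sigma> powr (- 1 / 2) * (1 - \<sigma>) powr (- 1 / 2))"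
  proof -
    have "4 * pi * (t - t * \<sigma>) * (t * \<sigma>) = t * (4 * (pi * (t * (\<sigma> * (1 - \<sigma>)))))"
      by (simp only: right_diff_distrib mult_1_right) (simp add: algebra_simps)
    then have "t / (4 * pi * (t - t * \<sigma>) * (t * \<sigma>)) = 1 / (4 * (pi * (t * (\<sigma> * (1 - \<sigma>)))))"
      using t by simp
    then have "sqrt (t / (4 * pi * (t - t * \<sigma>) * (t * \<sigma>))) = sqrt (1 / (4 * (pi * (t * (\<sigma> * (1 - \<sigma>))))))"
      by (rule arg_cong)
    also have "sqrt (1 / (4 * (pi * (t * (\<sigma> * (1 - \<sigma>)))))) = 1 / (2 * (sqrt pi * (sqrt t * (sqrt \<sigma> * sqrt (1 - \<sigma>)))))"
      by (simp only: real_sqrt_mult real_sqrt_divide real_sqrt_four real_sqrt_one)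
    finally have root: "sqrt (t / (4 * pi * (t - t * \<sigma>) * (t * \<sigma>))) = 1 / (2 * (sqrt pi * (sqrt t * (sqrt \<sigma> * sqrt (1 - \<sigma>)))))" .
    have "r powr (- 1 / 2) = 1 / sqrt r" if "0 < r" for r
      using that by (simp add: powr_minus powr_half_sqrt inverse_eq_divide)
    then show ?thesis
      unfolding root using t \<sigma> by simp
  qed
  have "heat1 (t - t * \<sigma>) (snd x) * heat1 (t * \<sigma>) (snd ?z)
     \<le> sqrt (t / (4 * pi * (t - t * \<sigma>) * (t * \<sigma>))) * heat1 t (snd x - snd ?z)"
    using heat1_mult_le [OF ts, of "snd x" "snd ?z"] by simp
  then have "P * (heat1 (t - t * \<sigma>) (snd x) * heat1 (t * \<sigma>) (snd ?z))
     \<le> P * (sqrt (t / (4 * pi * (t - t * \<sigma>) * (t * \<sigma>))) * heat1 t (snd x - snd ?z))"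
    by (intro mult_left_mono) (auto simp: P_def)
  also have "\<dots> = sqrt (t / (4 * pi * (t - t * \<sigma>) * (t * \<sigma>))) * Gam N x ?z t"
    using N t by (simp add: Gam_eq_heat_prod P_def)
  also have "\<dots> \<le> sqrt (t / (4 * pi * (t - t * \<sigma>) * (t * \<sigma>))) * Gk N x ?z t"
    using ts t \<sigma> by (intro mult_left_mono Gam_le_Gk real_sqrt_ge_zero divide_nonneg_nonneg mult_nonneg_nonneg) auto
  finally have le: "P * (heat1 (t - t * \<sigma>) (snd x) * heat1 (t * \<sigma>) (snd ?z))
     \<le> sqrt (t / (4 * pi * (t - t * \<sigma>) * (t * \<sigma>))) * Gk N x ?z t" .
  have "t * (B * (t * \<sigma>) powr (- a) * (4 * P * heat1 (t - t * \<sigma>) (snd x) * heat1 (t * \<sigma>) (snd ?z)))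
     = (4 * t * B * (t * \<sigma>) powr (- a)) * (P * (heat1 (t - t * \<sigma>) (snd x) * heat1 (t * \<sigma>) (snd ?z)))"
    by simp
  also have "\<dots> \<le> (4 * t * B * (t * \<sigma>) powr (- a)) * (sqrt (t / (4 * pi * (t - t * \<sigma>) * (t * \<sigma>))) * Gk N x ?z t)"
    using t B by (intro mult_left_mono le) auto
  also have "\<dots> = 2 / sqrt pi * B * t powr (1 / 2 - a) * ((\<sigma> powr (- a - 1 / 2) * (1 - \<sigma>) powr (- 1 / 2)) * Gk N x ?z t)"
  proof -
    have pw: "t * (t * \<sigma>) powr (- a) * t powr (- 1 / 2) * \<sigma> powr (- 1 / 2) = t powr (1 / 2 - a) * \<sigma> powr (- a - 1 / 2)"
    proof -
      have X: "t powr 1 * t powr (- a) * t powr (- 1 / 2) = t powr (1 / 2 - a)"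
        by (simp only: powr_add [symmetric]) simp
      have Y: "\<sigma> powr (- a) * \<sigma> powr (- 1 / 2) = \<sigma> powr (- a - 1 / 2)"
        by (simp only: powr_add [symmetric]) simp
      have "t * (t * \<sigma>) powr (- a) * t powr (- 1 / 2) * \<sigma> powr (- 1 / 2)
          = (t powr 1 * t powr (- a) * t powr (- 1 / 2)) * (\<sigma> powr (- a) * \<sigma> powr (- 1 / 2))"
        using t \<sigma> by (simp add: powr_mult)
      then show ?thesis unfolding X Y .
    qed
    have gen: "(4 * t * B * w) * ((1 / (2 * r) * t1 * (s1 * o1)) * g) = 2 / r * B * (t * w * t1 * s1) * (o1 * g)"
      for w r t1 s1 o1 g :: real by simp
    show ?thesis unfolding root gen unfolding pw by (simp only: mult.assoc)
  qed
  finally have "t * (B * (t * \<sigma>) powr (- a) * (4 * P * heat1 (t - t * \<sigma>) (snd x) * heat1 (t * \<sigma>) (snd ?z)))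
    \<le> 2 / sqrt pi * B * t powr (1 / 2 - a) * ((\<sigma> powr (- a - 1 / 2) * (1 - \<sigma>) powr (- 1 / 2)) * Gk N x ?z t)" .
  then have "ennreal (t * (B * (t * \<sigma>) powr (- a) * (4 * P * heat1 (t - t * \<sigma>) (snd x) * heat1 (t * \<sigma>) (snd ?z))))
    \<le> ennreal (2 / sqrt pi * B * t powr (1 / 2 - a)) * (ennreal (\<sigma> powr (- a - 1 / 2) * (1 - \<sigma>) powr (- 1 / 2)) * ennreal (Gk N x ?z t))"
    using B by (simp only: ennreal_mult [symmetric] ennreal_leI Gk_nonneg mult_nonneg_nonneg powr_ge_zero divide_nonneg_nonneg real_sqrt_ge_zero pi_ge_zero zero_le_numeral)
  then show ?thesis using True by (simp add: Hker_def Hdom_def P_def \<sigma>_def)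
qed (simp add: Hker_def)

lemma Hdom_measurable:
  assumes "sets \<mu> = sets (RN N)" and x [measurable]: "x \<in> space (RN N)"
  shows "Hdom N B a t x \<in> borel_measurable (lborel \<Otimes>\<^sub>M \<mu>)"
proof -
  have [measurable]: "(\<lambda>q. snd q) \<in> lborel \<Otimes>\<^sub>M \<mu> \<rightarrow>\<^sub>M RN N"
    by (rule measurable_compose [OF measurable_snd measurable_ident_RN [OF assms(1)]])
  show ?thesis unfolding Hdom_def [abs_def] by measurable
qed

lemma nn_integral_Hdom:
  assumes \<mu>: "sigma_finite_measure \<mu>" "sets \<mu> = sets (RN N)" and x [measurable]: "x \<in> space (RN N)"
  shows "(\<integral>\<^sup>+ q. Hdom N B a t x q \<partial>(lborel \<Otimes>\<^sub>M \<mu>)) = ennreal (2 / sqrt pi * B * t powr (1 / 2 - a)) * (beta_int a * Sop N \<mu> t x)"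
proof -
  interpret mu: sigma_finite_measure \<mu> by (rule \<mu>)
  have [measurable]: "(\<lambda>z. z) \<in> \<mu> \<rightarrow>\<^sub>M RN N" by (rule measurable_ident_RN [OF \<mu>(2)])
  have [measurable]: "(\<lambda>z. ennreal (Gk N x z t)) \<in> borel_measurable \<mu>" by measurable
  have "(\<integral>\<^sup>+ q. Hdom N B a t x q \<partial>(lborel \<Otimes>\<^sub>M \<mu>)) = (\<integral>\<^sup>+ s. \<integral>\<^sup>+ z. Hdom N B a t x (s, z) \<partial>\<mu> \<partial>lborel)"
    by (rule mu.nn_integral_fst [symmetric]) (rule Hdom_measurable [OF \<mu>(2) x])
  also have "\<dots> = (\<integral>\<^sup>+ s. ennreal (2 / sqrt pi * B * t powr (1 / 2 - a)) *
     (indicator {0<..<1} s * ennreal (s powr (- a - 1 / 2) * (1 - s) powr (- 1 / 2)) * Sop N \<mu> t x) \<partial>lborel)"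
    by (simp add: Hdom_def nn_integral_cmult Sop_def)
  also have "\<dots> = ennreal (2 / sqrt pi * B * t powr (1 / 2 - a)) * (beta_int a * Sop N \<mu> t x)"
    unfolding beta_int_def by (simp add: nn_integral_cmult nn_integral_multc)
  finally show ?thesis .
qed

text \<open>This closes the iteration: the potential of the majorant is bounded by a multiple of the
  free evolution at the same point and time.\<close>

lemma Psi_fstar_le:
  assumes N: "N \<ge> 1" and \<mu>: "sigma_finite_measure \<mu>" "sets \<mu> = sets (RN N)" and B: "0 \<le> B"
    and x: "x \<in> space (RN N)" and t: "0 < t"
  shows "Psi N (fstar N \<mu> B a) t x \<le> ennreal (2 / sqrt pi * B * t powr (1 / 2 - a)) * (beta_int a * Sop N \<mu> t x)"
  unfolding Psi_fstar [OF assms] nn_integral_Hdom [OF \<mu> x, symmetric]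
  by (intro nn_integral_mono Hker_le_Hdom N t B)

lemma tendsto_heat1:
  assumes "\<tau> \<longlonglongrightarrow> t" "0 < t" "g \<longlonglongrightarrow> b"
  shows "(\<lambda>n. heat1 (\<tau> n) (g n)) \<longlonglongrightarrow> heat1 t b"
  unfolding heat1_def normal_density_def using assms by (intro tendsto_intros) auto

text \<open>The majorant \<open>Hdom\<close> varies with n, but its integrals are explicit multiples
  of S\<mu> and converge by \<open>tendsto_Sop\<close>, as Pratt's lemma requires.\<close>

lemma tendsto_Psi_fstar:
  assumes N: "N \<ge> 1" and \<mu>: "sigma_finite_measure \<mu>" "sets \<mu> = sets (RN N)" and B: "0 \<le> B"
    and fin: "\<And>s. 0 < s \<Longrightarrow> s < T \<Longrightarrow> Sop N \<mu> s x < \<infinity>"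
    and X: "X \<longlonglongrightarrow> x" "\<And>n. X n \<in> space (RN N)" "x \<in> space (RN N)"
    and \<tau>: "\<tau> \<longlonglongrightarrow> t" "\<And>n. 0 < \<tau> n" and t: "0 < t" "t < T" and a: "0 \<le> a" "a < 1 / 2"
  shows "(\<lambda>n. Psi N (fstar N \<mu> B a) (\<tau> n) (X n)) \<longlonglongrightarrow> Psi N (fstar N \<mu> B a) t x"
  unfolding Psi_fstar [OF N \<mu> B X(2) \<tau>(2)] Psi_fstar [OF N \<mu> B X(3) t(1)]
proof (rule nn_integral_dominated_convergence_varying [where v = "\<lambda>n. Hdom N B a (\<tau> n) (X n)" and v' = "Hdom N B a t x"])
  let ?M = "lborel \<Otimes>\<^sub>M \<mu>"
  have b: "beta_int a \<noteq> \<infinity>" using beta_int_finite [OF a] by simp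
  have S: "Sop N \<mu> t x \<noteq> \<infinity>" using fin [OF t] by simp
  show "Hker N B a (\<tau> n) (X n) \<in> borel_measurable ?M" for n by (rule Hker_measurable [OF \<mu>(2) X(2)])
  show "Hker N B a t x \<in> borel_measurable ?M" by (rule Hker_measurable [OF \<mu>(2) X(3)])
  show "Hdom N B a (\<tau> n) (X n) \<in> borel_measurable ?M" for n by (rule Hdom_measurable [OF \<mu>(2) X(2)])
  show "Hdom N B a t x \<in> borel_measurable ?M" by (rule Hdom_measurable [OF \<mu>(2) X(3)])
  show "AE q in ?M. Hker N B a (\<tau> n) (X n) q \<le> Hdom N B a (\<tau> n) (X n) q" for n
    by (intro AE_I2 Hker_le_Hdom N \<tau> B)
  have c: "(\<lambda>n. ennreal (2 / sqrt pi * B * \<tau> n powr (1 / 2 - a))) \<longlonglongrightarrow> ennreal (2 / sqrt pi * B * t powr (1 / 2 - a))"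
    using t by (intro tendsto_intros \<tau>) auto
  show "AE q in ?M. (\<lambda>n. Hdom N B a (\<tau> n) (X n) q) \<longlonglongrightarrow> Hdom N B a t x q"
    unfolding Hdom_def
    by (intro AE_I2 tendsto_mult_ennreal c ennreal_tendsto_cmult tendsto_ennrealI tendsto_Gk X \<tau> t)
       (auto simp: indicator_def ennreal_mult_eq_top_iff ennreal_mult_less_top)
  show "(\<lambda>n. \<integral>\<^sup>+ q. Hdom N B a (\<tau> n) (X n) q \<partial>?M) \<longlonglongrightarrow> (\<integral>\<^sup>+ q. Hdom N B a t x q \<partial>?M)"
    unfolding nn_integral_Hdom [OF \<mu> X(2)] nn_integral_Hdom [OF \<mu> X(3)]
    using b S by (intro tendsto_mult_ennreal c ennreal_tendsto_cmult tendsto_Sop [OF \<mu>(2) fin X \<tau>(1) t])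
       (auto simp: ennreal_mult_eq_top_iff less_top)
  show "(\<integral>\<^sup>+ q. Hdom N B a t x q \<partial>?M) < \<infinity>"
    unfolding nn_integral_Hdom [OF \<mu> X(3)] using b S by (simp add: ennreal_mult_less_top less_top)
  show "AE q in ?M. (\<lambda>n. Hker N B a (\<tau> n) (X n) q) \<longlonglongrightarrow> Hker N B a t x q"
  proof (intro AE_I2)
    fix q :: "real \<times> pt"
    show "(\<lambda>n. Hker N B a (\<tau> n) (X n) q) \<longlonglongrightarrow> Hker N B a t x q"
    proof (cases "fst q \<in> {0<..<1}")
      case True
      then have pos: "0 < t * fst q" "0 < t - t * fst q" using t by auto
      show ?thesis
        unfolding Hker_def heat_prod_def using True pos t
        by (intro ennreal_tendsto_cmult tendsto_ennrealI tendsto_mult tendsto_powr tendsto_prod tendsto_heat1 tendsto_diff tendsto_const \<tau> tendsto_pt_coordinates X) auto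
    qed (simp add: Hker_def)
  qed
qed

text \<open>The singularity of the kernel at time s = \<tau> n moves with n. The integrand for
  \<open>fstar\<close> carries the same singularity and serves as varying majorant, its integrals
  converging by \<open>tendsto_Psi_fstar\<close>.\<close>

lemma tendsto_Psi:
  assumes N: "N \<ge> 1" and \<mu>: "sigma_finite_measure \<mu>" "sets \<mu> = sets (RN N)" and B: "0 \<le> B"
    and fin: "\<And>s y. 0 < s \<Longrightarrow> s < T \<Longrightarrow> y \<in> Dset N \<Longrightarrow> Sop N \<mu> s y < \<infinity>"
    and X: "X \<longlonglongrightarrow> x" "\<And>n. X n \<in> Dset N" "x \<in> Dset N"
    and \<tau>: "\<tau> \<longlonglongrightarrow> t" "\<And>n. 0 < \<tau> n" "\<And>n. \<tau> n < T" and t: "0 < t" "t < T" and a: "0 \<le> a" "a < 1 / 2"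
    and f: "f \<in> borel_measurable (bdry N \<Otimes>\<^sub>M lborel)"
    and le: "\<And>y s. y \<in> space (bdry N) \<Longrightarrow> 0 < s \<Longrightarrow> s < T \<Longrightarrow> f (y, s) \<le> fstar N \<mu> B a (y, s)"
  shows "(\<lambda>n. Psi N f (\<tau> n) (X n)) \<longlonglongrightarrow> Psi N f t x"
proof -
  interpret bd: sigma_finite_measure "bdry N" by (rule sigma_finite_bdry)
  interpret P: pair_sigma_finite "lborel :: real measure" "bdry N" ..
  let ?M = "lborel \<Otimes>\<^sub>M bdry N"
  note fs = fstar_measurable [OF \<mu>, of B a]
  have Xs: "X n \<in> space (RN N)" "x \<in> space (RN N)" for n using X by (simp_all add: Dset_eq)
  have finx: "Sop N \<mu> s x < \<infinity>" if "0 < s" "s < T" for s using fin [OF that X(3)] .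
  let ?u = "\<lambda>g t x q. indicator {0<..<t} (fst q) * (ennreal (Gk N x (snd q, 0) (t - fst q)) * g (snd q, fst q))"
  have meas: "?u g r y \<in> borel_measurable ?M"
    if "g \<in> borel_measurable (bdry N \<Otimes>\<^sub>M lborel)" and [measurable]: "y \<in> space (RN N)" for g :: "(nat \<Rightarrow> real) \<times> real \<Rightarrow> ennreal" and r y
  proof -
    have [measurable]: "(\<lambda>q. g (snd q, fst q)) \<in> borel_measurable (lborel \<Otimes>\<^sub>M bdry N)"
      by (rule measurable_compose [OF measurable_Pair [OF measurable_snd measurable_fst] that(1)])
    show ?thesis by measurable
  qed
  \<comment> \<open>Off the null set s = t the integrand is eventually either zero or a kernel at a
    time bounded away from 0, so it converges pointwise.\<close>
  have ne: "AE q in ?M. fst q \<noteq> t"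
  proof (rule P.AE_pair_measure)
    show "{q \<in> space ?M. fst q \<noteq> t} \<in> sets ?M" by measurable
    show "AE s in lborel. AE y in bdry N. fst (s, y) \<noteq> t"
      using AE_lborel_singleton [of t] by eventually_elim simp
  qed
  have fs_fin: "fstar N \<mu> B a (y, s) < \<infinity>" if "y \<in> space (bdry N)" "0 < s" "s < T" for y s
    using fin [of s "(y, 0)"] that by (auto simp: fstar_def ennreal_mult_less_top Dset_def space_bdry)
  have conv: "AE q in ?M. (\<lambda>n. ?u g (\<tau> n) (X n) q) \<longlonglongrightarrow> ?u g t x q"
    if g: "\<And>y s. y \<in> space (bdry N) \<Longrightarrow> 0 < s \<Longrightarrow> s < T \<Longrightarrow> g (y, s) < \<infinity>" for g :: "(nat \<Rightarrow> real) \<times> real \<Rightarrow> ennreal"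
  proof (rule AE_mp [OF ne], intro AE_I2 impI)
    fix q :: "real \<times> (nat \<Rightarrow> real)" assume q: "q \<in> space ?M" "fst q \<noteq> t"
    have y: "snd q \<in> space (bdry N)" using q by (auto simp: space_pair_measure)
    consider "fst q \<le> 0" | "0 < fst q" "fst q < t" | "t < fst q" using q by linarith
    then show "(\<lambda>n. ?u g (\<tau> n) (X n) q) \<longlonglongrightarrow> ?u g t x q"
    proof cases
      case 1
      then show ?thesis by simp
    next
      case 2
      have ev: "\<forall>\<^sub>F n in sequentially. fst q < \<tau> n" by (rule order_tendstoD(1) [OF \<tau>(1) 2(2)])
      have "(\<lambda>n. g (snd q, fst q) * ennreal (Gk N (X n) (snd q, 0) (\<tau> n - fst q))) \<longlonglongrightarrow> g (snd q, fst q) * ennreal (Gk N x (snd q, 0) (t - fst q))"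
        using g [OF y 2(1)] 2 t
        by (intro ennreal_tendsto_cmult tendsto_ennrealI tendsto_Gk X tendsto_diff \<tau> tendsto_const) auto
      then have "(\<lambda>n. ?u g (\<tau> n) (X n) q) \<longlonglongrightarrow> g (snd q, fst q) * ennreal (Gk N x (snd q, 0) (t - fst q))"
        by (rule Lim_transform_eventually) (use ev 2 in \<open>auto elim!: eventually_mono simp: mult.commute\<close>)
      then show ?thesis using 2 by (simp add: mult.commute)
    next
      case 3
      have "\<forall>\<^sub>F n in sequentially. \<tau> n < fst q" by (rule order_tendstoD(2) [OF \<tau>(1) 3])
      then have "\<forall>\<^sub>F n in sequentially. 0 = ?u g (\<tau> n) (X n) q" by eventually_elim simp
      then show ?thesis using 3 by (intro Lim_transform_eventually [OF tendsto_const]) auto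
    qed
  qed
  have star: "Psi N (fstar N \<mu> B a) t x < \<infinity>"
  proof -
    have "Psi N (fstar N \<mu> B a) t x \<le> ennreal (2 / sqrt pi * B * t powr (1 / 2 - a)) * (beta_int a * Sop N \<mu> t x)"
      by (rule Psi_fstar_le [OF N \<mu> B Xs(2) t(1)])
    also have "\<dots> < \<infinity>" using beta_int_finite [OF a] finx [OF t] by (simp add: ennreal_mult_less_top)
    finally show ?thesis .
  qed
  have le_u: "?u f r y q \<le> ?u (fstar N \<mu> B a) r y q" if "q \<in> space ?M" "r < T" for r y q
    using that le [of "snd q" "fst q"] by (auto simp: indicator_def space_pair_measure intro!: mult_left_mono)
  show ?thesis
    unfolding Psi_eq_pair [OF f Xs(1)] Psi_eq_pair [OF f Xs(2)]
  proof (rule nn_integral_dominated_convergence_varying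
      [where v = "\<lambda>n. ?u (fstar N \<mu> B a) (\<tau> n) (X n)" and v' = "?u (fstar N \<mu> B a) t x"])
    show "AE q in ?M. (\<lambda>n. ?u f (\<tau> n) (X n) q) \<longlonglongrightarrow> ?u f t x q"
      by (rule conv) (rule le_less_trans [OF le fs_fin])
    show "AE q in ?M. (\<lambda>n. ?u (fstar N \<mu> B a) (\<tau> n) (X n) q) \<longlonglongrightarrow> ?u (fstar N \<mu> B a) t x q"
      by (rule conv) (rule fs_fin)
    show "(\<lambda>n. \<integral>\<^sup>+ q. ?u (fstar N \<mu> B a) (\<tau> n) (X n) q \<partial>?M) \<longlonglongrightarrow> (\<integral>\<^sup>+ q. ?u (fstar N \<mu> B a) t x q \<partial>?M)"
      using tendsto_Psi_fstar [OF N \<mu> B finx X(1) Xs \<tau>(1,2) t a]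
      unfolding Psi_eq_pair [OF fs Xs(1)] Psi_eq_pair [OF fs Xs(2)] .
    show "(\<integral>\<^sup>+ q. ?u (fstar N \<mu> B a) t x q \<partial>?M) < \<infinity>"
      using star unfolding Psi_eq_pair [OF fs Xs(2)] .
    show "AE q in ?M. ?u f (\<tau> n) (X n) q \<le> ?u (fstar N \<mu> B a) (\<tau> n) (X n) q" for n
      by (intro AE_I2 le_u \<tau>)
  qed (intro meas f fs Xs)+
qed

section \<open>Picard iteration\<close>

text \<open>Sending \<infinity> to \<infinity> keeps the power monotone for p \<ge> 0 and, for p
  \<ge> 1, compatible with increasing suprema.\<close>

definition epowr :: "real \<Rightarrow> ennreal \<Rightarrow> ennreal" where
  "epowr p v = (if v = \<infinity> then \<infinity> else ennreal (enn2real v powr p))"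

lemma epowr_ennreal: "0 \<le> r \<Longrightarrow> epowr p (ennreal r) = ennreal (r powr p)"
  by (simp add: epowr_def)

lemma epowr_mono:
  assumes "0 \<le> p" "v \<le> w" shows "epowr p v \<le> epowr p w"
proof (cases "w = \<infinity>")
  case False
  then have "v \<noteq> \<infinity>" "enn2real v \<le> enn2real w"
    using assms by (auto simp: top_unique less_top intro!: enn2real_mono)
  then show ?thesis using False assms by (auto simp: epowr_def intro!: ennreal_leI powr_mono2)
qed (simp add: epowr_def)

lemma epowr_measurable [measurable (raw)]:
  assumes [measurable]: "f \<in> borel_measurable M"
  shows "(\<lambda>x. epowr p (f x)) \<in> borel_measurable M"
  unfolding epowr_def by measurable

text \<open>For \<open>epowr_SUP\<close> at an infinite supremum: this bound forces the powers to be
  unbounded too.\<close>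

lemma le_epowr_add_one:
  assumes "1 \<le> p" shows "v \<le> epowr p v + 1"
proof (cases v rule: ennreal_cases)
  case (real r)
  have "r \<le> r powr p + 1"
  proof (cases "1 \<le> r")
    case True
    then have "r powr 1 \<le> r powr p" using assms by (intro powr_mono) auto
    then show ?thesis using True by simp
  qed (use real in \<open>smt (verit) powr_ge_zero\<close>)
  then have "ennreal r \<le> ennreal (r powr p + 1)" by (rule ennreal_leI)
  then show ?thesis using real by (simp add: epowr_ennreal)
qed (simp add: epowr_def)

lemma epowr_SUP:
  fixes v :: "nat \<Rightarrow> ennreal"
  assumes p: "1 \<le> p" and v: "incseq v"
  shows "epowr p (SUP n. v n) = (SUP n. epowr p (v n))"
proof (cases "(SUP n. v n) = \<infinity>")
  case True
  have "(SUP n. v n) \<le> (SUP n. epowr p (v n)) + 1"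
  proof (rule SUP_least)
    fix n
    have "v n \<le> epowr p (v n) + 1" by (rule le_epowr_add_one [OF p])
    also have "\<dots> \<le> (SUP n. epowr p (v n)) + 1" by (rule add_right_mono) (rule SUP_upper, simp)
    finally show "v n \<le> (SUP n. epowr p (v n)) + 1" .
  qed
  then have "(SUP n. epowr p (v n)) = \<infinity>" unfolding True by (simp add: top_unique)
  moreover have "epowr p (SUP n. v n) = \<infinity>" unfolding True by (simp add: epowr_def)
  ultimately show ?thesis by order
next
  case False
  have fin: "v n \<noteq> \<infinity>" for n
  proof
    assume "v n = \<infinity>"
    then have "\<infinity> \<le> (SUP n. v n)" by (metis SUP_upper UNIV_I)
    with False show False unfolding infinity_ennreal_def top_unique by (rule notE)
  qed
  obtain L where L: "(SUP n. v n) = ennreal L" "0 \<le> L"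
    using False by (metis ennreal_cases infinity_ennreal_def)
  have "(\<lambda>n. v n) \<longlonglongrightarrow> ennreal L" using LIMSEQ_SUP [OF v] unfolding L(1) .
  then have "(\<lambda>n. enn2real (v n)) \<longlonglongrightarrow> L" by (rule tendsto_enn2real) (rule L)
  then have "(\<lambda>n. enn2real (v n) powr p) \<longlonglongrightarrow> L powr p"
    using p by (intro tendsto_powr' tendsto_const) auto
  then have "(\<lambda>n. epowr p (v n)) \<longlonglongrightarrow> ennreal (L powr p)"
    using fin by (simp add: epowr_def tendsto_ennrealI)
  moreover have "(\<lambda>n. epowr p (v n)) \<longlonglongrightarrow> (SUP n. epowr p (v n))"
    using p v by (intro LIMSEQ_SUP) (auto simp: incseq_def intro!: epowr_mono)
  ultimately have "ennreal (L powr p) = (SUP n. epowr p (v n))" by (rule LIMSEQ_unique)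
  then show ?thesis unfolding L(1) using L(2) by (simp add: epowr_ennreal)
qed

text \<open>The potential at time t sees only 0 < s < t, which matters because the bounds on the
  source are available only before time T.\<close>

lemma Psi_mono:
  assumes "\<And>y s. y \<in> space (bdry N) \<Longrightarrow> 0 < s \<Longrightarrow> s < t \<Longrightarrow> f (y, s) \<le> g (y, s)"
  shows "Psi N f t x \<le> Psi N g t x"
  unfolding Psi_def
proof (intro nn_integral_mono)
  fix s
  show "indicator {0<..<t} s * (\<integral>\<^sup>+ y. ennreal (Gk N x (y, 0) (t - s)) * f (y, s) \<partial>bdry N)
    \<le> indicator {0<..<t} s * (\<integral>\<^sup>+ y. ennreal (Gk N x (y, 0) (t - s)) * g (y, s) \<partial>bdry N)"
    by (cases "s \<in> {0<..<t}") (auto intro!: nn_integral_mono mult_left_mono assms)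
qed

lemma Psi_SUP:
  assumes f: "\<And>n. f n \<in> borel_measurable (bdry N \<Otimes>\<^sub>M lborel)" "incseq f" and x: "x \<in> space (RN N)"
  shows "Psi N (\<lambda>q. SUP n. f n q) t x = (SUP n. Psi N (f n) t x)"
proof -
  have m: "(\<lambda>q. SUP n. f n q) \<in> borel_measurable (bdry N \<Otimes>\<^sub>M lborel)"
    by (intro borel_measurable_SUP f) simp
  let ?u = "\<lambda>g q. indicator {0<..<t} (fst q) * (ennreal (Gk N x (snd q, 0) (t - fst q)) * g (snd q, fst q))"
  have [measurable]: "?u (f n) \<in> borel_measurable (lborel \<Otimes>\<^sub>M bdry N)" for n
  proof -
    note x [measurable]
    have [measurable]: "(\<lambda>q. f n (snd q, fst q)) \<in> borel_measurable (lborel \<Otimes>\<^sub>M bdry N)"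
      by (rule measurable_compose [OF measurable_Pair [OF measurable_snd measurable_fst] f(1)])
    show ?thesis by measurable
  qed
  have "(\<integral>\<^sup>+ q. ?u (\<lambda>q. SUP n. f n q) q \<partial>(lborel \<Otimes>\<^sub>M bdry N)) = (\<integral>\<^sup>+ q. (SUP n. ?u (f n) q) \<partial>(lborel \<Otimes>\<^sub>M bdry N))"
    by (simp only: SUP_mult_left_ennreal)
  also have "\<dots> = (SUP n. \<integral>\<^sup>+ q. ?u (f n) q \<partial>(lborel \<Otimes>\<^sub>M bdry N))"
  proof (rule nn_integral_monotone_convergence_SUP)
    show "incseq (\<lambda>n. ?u (f n))"
      using f(2) by (auto simp: incseq_def le_fun_def intro!: mult_left_mono)
  qed measurable
  finally show ?thesis unfolding Psi_eq_pair [OF m x] Psi_eq_pair [OF f(1) x] .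
qed

text \<open>The integral equation closes on the boundary values, so only these are iterated.
  Starting from 0 makes the sequence increasing.\<close>

primrec picard :: "nat \<Rightarrow> real \<Rightarrow> pt measure \<Rightarrow> nat \<Rightarrow> (nat \<Rightarrow> real) \<times> real \<Rightarrow> ennreal" where
  "picard N p \<mu> 0 = (\<lambda>q. 0)"
| "picard N p \<mu> (Suc n) = (\<lambda>q. Sop N \<mu> (snd q) (fst q, 0) + Psi N (\<lambda>q. epowr p (picard N p \<mu> n q)) (snd q) (fst q, 0))"

lemma picard_measurable:
  assumes "sigma_finite_measure \<mu>" "sets \<mu> = sets (RN N)"
  shows "picard N p \<mu> n \<in> borel_measurable (bdry N \<Otimes>\<^sub>M lborel)"
proof (induction n)
  case (Suc n)
  have "(\<lambda>q. epowr p (picard N p \<mu> n q)) \<in> borel_measurable (bdry N \<Otimes>\<^sub>M lborel)"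
    using Suc by (rule epowr_measurable)
  then have "(\<lambda>q. Psi N (\<lambda>q. epowr p (picard N p \<mu> n q)) (snd q) (fst q, 0)) \<in> borel_measurable (bdry N \<Otimes>\<^sub>M lborel)"
    by (rule Psi_measurable) measurable
  moreover have "(\<lambda>q. Sop N \<mu> (snd q) (fst q, 0)) \<in> borel_measurable (bdry N \<Otimes>\<^sub>M lborel)"
    by (rule Sop_measurable [OF assms]) measurable
  ultimately show ?case by simp
qed simp

lemma picard_incseq:
  assumes "0 \<le> p" shows "incseq (picard N p \<mu>)"
proof (rule incseq_SucI)
  fix n show "picard N p \<mu> n \<le> picard N p \<mu> (Suc n)"
  proof (induction n)
    case (Suc n)
    then have "epowr p (picard N p \<mu> n q) \<le> epowr p (picard N p \<mu> (Suc n) q)" for q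
      by (intro epowr_mono assms) (rule le_funD)
    then have "Psi N (\<lambda>q. epowr p (picard N p \<mu> n q)) (snd q) (fst q, 0)
      \<le> Psi N (\<lambda>q. epowr p (picard N p \<mu> (Suc n) q)) (snd q) (fst q, 0)" for q
      by (rule Psi_mono)
    then show ?case
      unfolding picard.simps(2) [of N p \<mu> n] picard.simps(2) [of N p \<mu> "Suc n"] le_fun_def by (auto intro: add_left_mono)
  qed (simp add: le_fun_def)
qed

text \<open>Separates the iteration from the choice of constants: \<open>pw\<close> and
  \<open>small\<close> are the two inequalities that smallness of the datum has to supply.\<close>

lemma solution_exists:
  assumes N: "N \<ge> 1" and R: "radon_on_D N \<mu>" and p: "1 \<le> p" and B: "0 \<le> B" and a: "0 \<le> a" "a < 1 / 2"
    and fin: "\<And>t x. 0 < t \<Longrightarrow> t < T \<Longrightarrow> x \<in> Dset N \<Longrightarrow> Sop N \<mu> t x < \<infinity>"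
    and pw: "\<And>y s. y \<in> space (bdry N) \<Longrightarrow> 0 < s \<Longrightarrow> s < T \<Longrightarrow> epowr p (2 * Sop N \<mu> s (y, 0)) \<le> fstar N \<mu> B a (y, s)"
    and small: "\<And>t x. 0 < t \<Longrightarrow> t < T \<Longrightarrow> x \<in> Dset N \<Longrightarrow> Psi N (fstar N \<mu> B a) t x \<le> Sop N \<mu> t x"
  shows "\<exists>u. is_solution N p \<mu> T u \<and> (\<forall>x\<in>Dset N. \<forall>t\<in>{0<..<T}. 0 \<le> u x t \<and> ennreal (u x t) \<le> 2 * Sop N \<mu> t x)"
proof -
  note S = radon_on_D_sets [OF R] and sf = radon_on_D_sigma_finite [OF R]
  have p0: "0 \<le> p" using p by simp
  note incseq_p = picard_incseq [OF p0, of N \<mu>] and meas_p = picard_measurable [OF sf S, of p]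
  have D0: "(y, 0) \<in> Dset N" "(y, 0) \<in> space (RN N)" if "y \<in> space (bdry N)" for y
    using that by (simp_all add: Dset_def space_bdry space_RN)
  define V where "V q = (SUP n. picard N p \<mu> n q)" for q
  define F where "F q = epowr p (V q)" for q
  have incq: "incseq (\<lambda>n. picard N p \<mu> n q)" for q
    by (rule incseq_SucI) (rule le_funD [OF incseq_SucD [OF incseq_p]])
  have F_SUP: "F = (\<lambda>q. SUP n. epowr p (picard N p \<mu> n q))"
    unfolding F_def [abs_def] V_def by (intro ext epowr_SUP p incq)
  have incF: "incseq (\<lambda>n q. epowr p (picard N p \<mu> n q))"
    using incq p by (auto simp: incseq_def le_fun_def intro!: epowr_mono)
  have Fm: "F \<in> borel_measurable (bdry N \<Otimes>\<^sub>M lborel)"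
    unfolding F_SUP by (intro borel_measurable_SUP epowr_measurable meas_p) simp
  \<comment> \<open>By monotone convergence V solves the boundary equation in
    \<open>ennreal\<close>, at every s and possibly with infinite values.\<close>
  have V_eq: "V (y, s) = Sop N \<mu> s (y, 0) + Psi N F s (y, 0)" if y: "y \<in> space (bdry N)" for y s
  proof -
    have "V (y, s) = (SUP n. picard N p \<mu> (Suc n) (y, s))"
      unfolding V_def using incseq_SucD [OF incq] by (intro antisym SUP_mono) blast+
    also have "\<dots> = Sop N \<mu> s (y, 0) + (SUP n. Psi N (\<lambda>q. epowr p (picard N p \<mu> n q)) s (y, 0))"
      by (simp add: ennreal_SUP_add_right)
    also have "(SUP n. Psi N (\<lambda>q. epowr p (picard N p \<mu> n q)) s (y, 0)) = Psi N F s (y, 0)"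
      unfolding F_SUP by (rule Psi_SUP [OF _ incF D0(2) [OF y], symmetric]) (intro epowr_measurable meas_p)
    finally show ?thesis .
  qed
  \<comment> \<open>The bound reproduces itself: below 2 S\<mu> the power is below
    \<open>fstar\<close>, whose potential is at most S\<mu>. The induction keeps y and s general
    because the potential looks at earlier times.\<close>
  have bound: "picard N p \<mu> n (y, s) \<le> 2 * Sop N \<mu> s (y, 0)"
    if "y \<in> space (bdry N)" "0 < s" "s < T" for n y s
    using that
  proof (induction n arbitrary: y s)
    case (Suc n)
    have "Psi N (\<lambda>q. epowr p (picard N p \<mu> n q)) s (y, 0) \<le> Psi N (fstar N \<mu> B a) s (y, 0)"
    proof (rule Psi_mono)
      fix y' s' assume *: "y' \<in> space (bdry N)" "0 < s'" "s' < s"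
      then have "epowr p (picard N p \<mu> n (y', s')) \<le> epowr p (2 * Sop N \<mu> s' (y', 0))"
        using Suc p by (intro epowr_mono Suc.IH) auto
      also have "\<dots> \<le> fstar N \<mu> B a (y', s')" using * Suc by (intro pw) auto
      finally show "epowr p (picard N p \<mu> n (y', s')) \<le> fstar N \<mu> B a (y', s')" .
    qed
    also have "\<dots> \<le> Sop N \<mu> s (y, 0)" using Suc.prems by (intro small D0) auto
    finally have "Sop N \<mu> s (y, 0) + Psi N (\<lambda>q. epowr p (picard N p \<mu> n q)) s (y, 0) \<le> Sop N \<mu> s (y, 0) + Sop N \<mu> s (y, 0)"
      by (rule add_left_mono)
    then show ?case by (simp add: mult_2)
  qed simp
  have V_le: "V (y, s) \<le> 2 * Sop N \<mu> s (y, 0)" if "y \<in> space (bdry N)" "0 < s" "s < T" for y s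
    unfolding V_def by (intro SUP_least bound that)
  have F_le: "F (y, s) \<le> fstar N \<mu> B a (y, s)" if "y \<in> space (bdry N)" "0 < s" "s < T" for y s
    unfolding F_def using p by (intro order_trans [OF epowr_mono pw [OF that]] V_le [OF that]) simp
  \<comment> \<open>One more application of the integral formula extends V from the boundary to the
    half space. \<open>fin_sum\<close> rules out the default value of \<open>enn2real\<close> at
    \<infinity> on the relevant domain.\<close>
  define u where "u x t = enn2real (Sop N \<mu> t x + Psi N F t x)" for x t
  have Psi_le: "Psi N F t x \<le> Sop N \<mu> t x" if "x \<in> Dset N" "0 < t" "t < T" for x t
  proof -
    have "Psi N F t x \<le> Psi N (fstar N \<mu> B a) t x" using that by (intro Psi_mono F_le) auto
    also have "\<dots> \<le> Sop N \<mu> t x" using that by (intro small) auto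
    finally show ?thesis .
  qed
  have fin_sum: "Sop N \<mu> t x + Psi N F t x < \<infinity>" if "x \<in> Dset N" "0 < t" "t < T" for x t
    using fin [OF that(2,3,1)] Psi_le [OF that] by (simp add: less_top [symmetric]) (metis top_unique)
  have u_eq: "ennreal (u x t) = Sop N \<mu> t x + Psi N F t x" if "x \<in> Dset N" "0 < t" "t < T" for x t
    unfolding u_def using fin_sum [OF that] by simp
  \<comment> \<open>On the boundary u agrees with V, so the source F built from V is indeed the
    power of u.\<close>
  have u_bdry: "ennreal (u (y, 0) s powr p) = F (y, s)" if "y \<in> space (bdry N)" "0 < s" "s < T" for y s
  proof -
    have "ennreal (u (y, 0) s) = V (y, s)" using u_eq [OF D0(1) that(2,3)] V_eq that by simp
    then have "F (y, s) = epowr p (ennreal (u (y, 0) s))" by (simp add: F_def)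
    then show ?thesis by (simp add: epowr_ennreal u_def)
  qed
  have integral_eq: "(\<integral>\<^sup>+ s. indicator {0<..<t} s *
      (\<integral>\<^sup>+ y'. ennreal (Gk N x (y', 0) (t - s) * u (y', 0) s powr p) \<partial>bdry N) \<partial>lborel) = Psi N F t x"
    if "0 < t" "t < T" for x t
    unfolding Psi_def
  proof (intro nn_integral_cong)
    fix s
    show "indicator {0<..<t} s * (\<integral>\<^sup>+ y'. ennreal (Gk N x (y', 0) (t - s) * u (y', 0) s powr p) \<partial>bdry N)
      = indicator {0<..<t} s * (\<integral>\<^sup>+ y. ennreal (Gk N x (y, 0) (t - s)) * F (y, s) \<partial>bdry N)"
    proof (cases "s \<in> {0<..<t}")
      case True
      then have "(\<integral>\<^sup>+ y'. ennreal (Gk N x (y', 0) (t - s) * u (y', 0) s powr p) \<partial>bdry N)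
         = (\<integral>\<^sup>+ y. ennreal (Gk N x (y, 0) (t - s)) * F (y, s) \<partial>bdry N)"
        using that by (intro nn_integral_cong) (simp add: ennreal_mult u_bdry)
      then show ?thesis by simp
    qed simp
  qed
  have cont: "continuous_on (Dset N \<times> {0<..<T}) (\<lambda>(x, t). u x t)"
    unfolding continuous_on_sequentially
  proof (intro allI ballI impI)
    fix Z and z :: "pt \<times> real"
    assume z: "z \<in> Dset N \<times> {0<..<T}" and "(\<forall>n. Z n \<in> Dset N \<times> {0<..<T}) \<and> Z \<longlonglongrightarrow> z"
    then have Z: "\<And>n. Z n \<in> Dset N \<times> {0<..<T}" "Z \<longlonglongrightarrow> z" by auto
    define X where "X n = fst (Z n)" for n
    define \<tau> where "\<tau> n = snd (Z n)" for n
    define x where "x = fst z"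
    define t where "t = snd z"
    have X: "X \<longlonglongrightarrow> x" "\<And>n. X n \<in> Dset N" "x \<in> Dset N"
      using Z z unfolding X_def [abs_def] x_def by (auto intro!: tendsto_fst simp: mem_Times_iff)
    have \<tau>: "\<tau> \<longlonglongrightarrow> t" "\<And>n. 0 < \<tau> n" "\<And>n. \<tau> n < T" "0 < t" "t < T"
      using Z z unfolding \<tau>_def [abs_def] t_def by (auto intro!: tendsto_snd simp: mem_Times_iff)
    have Xs: "\<And>n. X n \<in> space (RN N)" "x \<in> space (RN N)" using X by (simp_all add: Dset_eq)
    have "(\<lambda>n. Sop N \<mu> (\<tau> n) (X n) + Psi N F (\<tau> n) (X n)) \<longlonglongrightarrow> Sop N \<mu> t x + Psi N F t x"
      using tendsto_Sop [OF S fin [OF _ _ X(3)] X(1) Xs \<tau>(1,4,5)]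
        tendsto_Psi [OF N sf S B fin X \<tau> a Fm F_le] by (intro tendsto_add) auto
    also have "Sop N \<mu> t x + Psi N F t x = ennreal (u x t)" using u_eq X \<tau> by simp
    finally have "(\<lambda>n. u (X n) (\<tau> n)) \<longlonglongrightarrow> u x t"
      unfolding u_def by (rule tendsto_enn2real) simp
    then show "((\<lambda>(x, t). u x t) \<circ> Z) \<longlonglongrightarrow> (case z of (x, t) \<Rightarrow> u x t)"
      by (simp add: X_def \<tau>_def x_def t_def split_beta' o_def)
  qed
  show ?thesis
  proof (intro exI [of _ u] conjI ballI)
    show "is_solution N p \<mu> T u"
      unfolding is_solution_def
      by (intro conjI ballI cont) (simp add: u_def, simp add: u_eq integral_eq)
    show "0 \<le> u x t" for x t by (simp add: u_def)
    show "ennreal (u x t) \<le> 2 * Sop N \<mu> t x" if "x \<in> Dset N" "t \<in> {0<..<T}" for x t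
    proof -
      have "ennreal (u x t) \<le> Sop N \<mu> t x + Sop N \<mu> t x"
        using that u_eq [of x t] Psi_le [of x t] by (auto intro: add_left_mono)
      then show ?thesis by (simp add: mult_2)
    qed
  qed
qed

text \<open>Of the p factors v only p - 1 are replaced by the bound c. The one that is kept makes
  the majorant linear in v, as \<open>fstar\<close> requires.\<close>

lemma epowr_two_mult_le:
  assumes p: "1 < p" and v: "v \<le> ennreal c" and c: "0 \<le> c"
  shows "epowr p (2 * v) \<le> ennreal (2 powr p * c powr (p - 1)) * v"
proof -
  obtain r where r: "v = ennreal r" "0 \<le> r" using v by (metis ennreal_cases ennreal_neq_top top_unique)
  have "r \<le> c" using v c unfolding r(1) by simp
  have "(2 * r) powr p = 2 powr p * r powr (p - 1) * r"
  proof (cases "r = 0")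
    case False
    then have "r powr p = r powr (p - 1) * r powr 1" using r by (simp only: powr_add [symmetric]) simp
    then show ?thesis using r by (simp add: powr_mult)
  qed simp
  also have "\<dots> \<le> 2 powr p * c powr (p - 1) * r"
    using p r \<open>r \<le> c\<close> by (intro mult_right_mono mult_left_mono powr_mono2) auto
  finally have "ennreal ((2 * r) powr p) \<le> ennreal (2 powr p * c powr (p - 1) * r)" by (rule ennreal_leI)
  moreover have "2 * v = ennreal (2 * r)" unfolding r(1) using r(2) by (simp add: ennreal_mult)
  moreover have "ennreal (2 powr p * c powr (p - 1) * r) = ennreal (2 powr p * c powr (p - 1)) * v"
    unfolding r(1) by (intro ennreal_mult) (use r in auto)
  ultimately show ?thesis using r(2) by (simp add: epowr_ennreal)
qed

section \<open>Choice of the constants and cancellation of the powers of T\<close>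

theorem theorem1p3:
  fixes N :: nat and p \<delta> :: real
  assumes "N \<ge> 1" and "1 < p" and "p < 1 + 1 / real N" and "0 < \<delta>" and "\<delta> < 1"
  shows "\<exists>\<gamma>2 > 0. \<forall>T \<mu>. 0 < T \<and> radon_on_D N \<mu> \<and>
     (\<forall>x\<in>Dset N.
        (\<integral>\<^sup>+ y\<in>Ball N x (sqrt T). ennreal (exp (- ((1 - \<delta>) / (4 * T)) * (snd y)^2)) \<partial>\<mu>)
        \<le> ennreal (\<gamma>2 * T powr (- 1 / (2 * (p - 1))) * measure (RN N) (Ball N x (sqrt T))))
     \<longrightarrow> (\<exists>u. is_solution N p \<mu> T u \<and>
            (\<forall>x\<in>Dset N. \<forall>t\<in>{0<..<T}. 0 \<le> u x t \<and> ennreal (u x t) \<le> 2 * Sop N \<mu> t x))"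
proof -
  note N = assms(1) and p = assms(2) and \<delta> = assms(4,5)
  define a where "a = real N * (p - 1) / 2"
  have a: "0 \<le> a" "a < 1 / 2"
    using assms by (auto simp: a_def field_simps)
  define C where "C = Sop_bound_const N \<delta> * 2 ^ N"
  have C: "0 < C" using Sop_bound_const_pos [OF N \<delta>(1)] by (simp add: C_def)
  obtain b where b: "beta_int a = ennreal b" "0 \<le> b"
    using beta_int_finite [OF a] by (metis ennreal_cases less_irrefl infinity_ennreal_def)
  \<comment> \<open>K times \<open>\<gamma> powr (p - 1)\<close> bounds the factor in
    \<open>Psi_fstar_le\<close>, and \<gamma> makes this product 1. Taking \<open>b + 1\<close>
    instead of b gives K > 0 without a lower bound on the beta integral.\<close>
  define K where "K = 2 / sqrt pi * 2 powr p * C powr (p - 1) * (b + 1)"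
  have K: "0 < K" using C b by (simp add: K_def)
  define \<gamma> where "\<gamma> = K powr (- 1 / (p - 1))"
  have \<gamma>: "0 < \<gamma>" "\<gamma> powr (p - 1) = 1 / K"
  proof -
    show "0 < \<gamma>" using K by (simp add: \<gamma>_def)
    have "- 1 / (p - 1) * (p - 1) = - 1" using p by simp
    then show "\<gamma> powr (p - 1) = 1 / K"
      unfolding \<gamma>_def powr_powr using K by (simp only: powr_minus powr_one' inverse_eq_divide abs_of_pos)
  qed
  show ?thesis
  proof (intro exI [of _ \<gamma>] conjI allI impI \<gamma>, elim conjE)
    fix T :: real and \<mu> :: "pt measure"
    assume T: "0 < T" and R: "radon_on_D N \<mu>"
      and hyp: "\<forall>x\<in>Dset N.
        (\<integral>\<^sup>+ y\<in>Ball N x (sqrt T). ennreal (exp (- ((1 - \<delta>) / (4 * T)) * (snd y)^2)) \<partial>\<mu>)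
        \<le> ennreal (\<gamma> * T powr (- 1 / (2 * (p - 1))) * measure (RN N) (Ball N x (sqrt T)))"
    define M where "M = \<gamma> * T powr (- 1 / (2 * (p - 1))) * (2 * sqrt T) ^ N"
    have M: "0 \<le> M" using \<gamma> T by (simp add: M_def)
    have ball: "(\<integral>\<^sup>+ y\<in>Ball N x (sqrt T). ennreal (exp (- ((1 - \<delta>) / (4 * T)) * (snd y)\<^sup>2)) \<partial>\<mu>) \<le> ennreal M"
      if "x \<in> Dset N" for x
    proof (rule order_trans [OF bspec [OF hyp that]], rule ennreal_leI)
      show "\<gamma> * T powr (- 1 / (2 * (p - 1))) * measure (RN N) (Ball N x (sqrt T)) \<le> M"
        unfolding M_def using \<gamma> T by (intro mult_left_mono measure_Ball_le N) auto
    qed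
    define A where "A = Sop_bound_const N \<delta> * M"
    have A: "0 \<le> A" using M Sop_bound_const_pos [OF N \<delta>(1)] by (simp add: A_def)
    have A_eq: "A = C * \<gamma> * (T powr (- 1 / (2 * (p - 1))) * T powr (real N / 2))"
    proof -
      have "sqrt T ^ N = T powr (real N / 2)"
        using T by (simp add: powr_half_sqrt [symmetric] powr_realpow [symmetric] powr_powr)
      then show ?thesis by (simp add: A_def M_def C_def power_mult_distrib)
    qed
    note Sop_bound = Sop_le [OF N R _ _ \<delta> ball M]
    \<comment> \<open>From \<open>epowr_two_mult_le\<close> with the boundary bound
      \<open>A * s powr (- real N / 2)\<close>: raising it to p - 1 turns the exponent N/2 into
      a.\<close>
    define B where "B = 2 powr p * A powr (p - 1)"
    have B: "0 \<le> B" by (simp add: B_def)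
    show "\<exists>u. is_solution N p \<mu> T u \<and> (\<forall>x\<in>Dset N. \<forall>t\<in>{0<..<T}. 0 \<le> u x t \<and> ennreal (u x t) \<le> 2 * Sop N \<mu> t x)"
    proof (rule solution_exists [OF N R _ B a])
      show "1 \<le> p" using p by simp
      show "Sop N \<mu> t x < \<infinity>" if "0 < t" "t < T" "x \<in> Dset N" for t x
        using le_less_trans [OF Sop_bound [of t x] ennreal_less_top] that by simp
      show "epowr p (2 * Sop N \<mu> s (y, 0)) \<le> fstar N \<mu> B a (y, s)"
        if y: "y \<in> space (bdry N)" and s: "0 < s" "s < T" for y s
      proof -
        have "Sop N \<mu> s (y, 0) \<le> ennreal (A * s powr (- real N / 2))"
          using Sop_bound [of s "(y, 0)"] y s by (simp add: A_def Dset_def space_bdry mult_ac)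
        then have "epowr p (2 * Sop N \<mu> s (y, 0))
            \<le> ennreal (2 powr p * (A * s powr (- real N / 2)) powr (p - 1)) * Sop N \<mu> s (y, 0)"
          by (rule epowr_two_mult_le [OF p]) (use A in simp)
        also have "2 powr p * (A * s powr (- real N / 2)) powr (p - 1) = B * s powr (- a)"
        proof -
          have "(s powr (- real N / 2)) powr (p - 1) = s powr (- a)"
            by (simp add: powr_powr a_def)
          then show ?thesis using A by (simp add: powr_mult B_def)
        qed
        finally show ?thesis by (simp add: fstar_def)
      qed
      show "Psi N (fstar N \<mu> B a) t x \<le> Sop N \<mu> t x" if t: "0 < t" "t < T" and x: "x \<in> Dset N" for t x
      proof -
        have xs: "x \<in> space (RN N)" using x by (simp add: Dset_eq)
        \<comment> \<open>As 1/2 - a > 0, the worst time is T.\<close>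
        have "B * t powr (1 / 2 - a) \<le> B * T powr (1 / 2 - a)"
          using t a B by (intro mult_left_mono powr_mono2) auto
        also have "\<dots> = 2 powr p * C powr (p - 1) / K"
        proof -
          have "(T powr (- 1 / (2 * (p - 1))) * T powr (real N / 2)) powr (p - 1) * T powr (1 / 2 - a) = 1"
          proof -
            \<comment> \<open>Scale invariance: the power of T in the ball condition is exactly the
              one that makes this sum vanish, so \<gamma> is independent of T.\<close>
            have "(- 1 / (2 * (p - 1)) + real N / 2) * (p - 1) + (1 / 2 - a) = 0"
              using p by (simp add: a_def field_simps)
            then show ?thesis using T by (simp only: powr_add [symmetric] powr_powr) simp
          qed
          moreover have "A powr (p - 1) = C powr (p - 1) * \<gamma> powr (p - 1) * (T powr (- 1 / (2 * (p - 1))) * T powr (real N / 2)) powr (p - 1)"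
            unfolding A_eq using C \<gamma> by (simp only: powr_mult)
          ultimately show ?thesis by (simp add: B_def \<gamma>)
        qed
        finally have le: "B * t powr (1 / 2 - a) \<le> 2 powr p * C powr (p - 1) / K" .
        have "2 / sqrt pi * (B * t powr (1 / 2 - a)) * b \<le> 2 / sqrt pi * (2 powr p * C powr (p - 1) / K) * (b + 1)"
          using b C K by (intro mult_mono [OF mult_left_mono [OF le]]) auto
        also have "\<dots> = K / K" by (simp add: K_def)
        also have "\<dots> = 1" using K by simp
        finally have le1: "ennreal (2 / sqrt pi * B * t powr (1 / 2 - a) * b) \<le> 1"
          by (simp add: mult.assoc)
        have eq: "ennreal (2 / sqrt pi * B * t powr (1 / 2 - a) * b) = ennreal (2 / sqrt pi * B * t powr (1 / 2 - a)) * beta_int a"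
          unfolding b(1) using B b by (intro ennreal_mult) auto
        have "ennreal (2 / sqrt pi * B * t powr (1 / 2 - a)) * beta_int a * Sop N \<mu> t x \<le> 1 * Sop N \<mu> t x"
          by (rule mult_right_mono [OF le1 [unfolded eq]]) simp
        then show ?thesis
          using order_trans [OF Psi_fstar_le [OF N radon_on_D_sigma_finite [OF R] radon_on_D_sets [OF R] B xs t(1)]]
          by (simp add: mult.assoc)
      qed
    qed
  qed
qed

end
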